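(* Let $R=\mathbb{F}_2\langle a,x : a=a^2x\rangle$. Then $R$ is left Dischinger. Moreover, for every $f\in R$, if $Rf=Rf^2$ then either $f=0$ or $f$ is a unit of $R$.
   Context: $R=\mathbb{F}_2\langle a,x: a=a^2x\rangle$ denotes the quotient of the free unital associative (noncommutative) $\mathbb{F}_2$-algebra on two generators $a,x$ by the two-sided ideal generated by $a-a^2x$. An element $s$ of a ring $S$ is right strongly regular if $s=s^2t$ for some $t\in S$, left strongly regular if $s=ts^2$ for some $t\in S$, and strongly regular if both. A ring $S$ is left Dischinger if every left strongly regular element of $S$ is strongly regular. *)

theory Defs
  imports "HOL-Algebra.QuotRing" "HOL-Library.Poly_Mapping" "HOL-Library.Z2"
begin

text \<open>
  The free monoid on a set of generators. It is a copy of \<open>'a list\<close>, written additively because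
  the convolution product on \<open>'m \<Rightarrow>\<^sub>0 'c\<close> is based on \<open>+\<close> on the index type \<open>'m\<close>;
  the addition is concatenation, so it is not commutative.
\<close>

datatype 'a free_monoid = Mon (letters: "'a list")

instantiation free_monoid :: (type) monoid_add
begin

definition zero_free_monoid :: "'a free_monoid"
  where "0 = Mon []"

definition plus_free_monoid :: "'a free_monoid \<Rightarrow> 'a free_monoid \<Rightarrow> 'a free_monoid"
  where "u + v = Mon (letters u @ letters v)"

instance
  by standard (simp_all add: zero_free_monoid_def plus_free_monoid_def)

end

text \<open>
  The free unital associative algebra over \<open>'c\<close> is the monoid algebra of the free monoid: finitely
  supported functions from words to \<open>'c\<close> with the convolution product.
\<close>

definition free_algebra :: "('a free_monoid \<Rightarrow>\<^sub>0 'c::comm_ring_1) ring"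
  where "free_algebra = \<lparr>carrier = UNIV, mult = (*), one = 1, zero = 0, add = (+)\<rparr>"

definition free_gen :: "'a \<Rightarrow> 'a free_monoid \<Rightarrow>\<^sub>0 'c::comm_ring_1"
  where "free_gen g = Poly_Mapping.single (Mon [g]) 1"

lemma ring_free_algebra: "ring (free_algebra :: ('a free_monoid \<Rightarrow>\<^sub>0 'c::comm_ring_1) ring)"
proof (rule ringI)
  show "abelian_group (free_algebra :: ('a free_monoid \<Rightarrow>\<^sub>0 'c) ring)"
  proof (rule abelian_groupI)
    fix p :: "'a free_monoid \<Rightarrow>\<^sub>0 'c"
    show "\<exists>q\<in>carrier free_algebra. q \<oplus>\<^bsub>free_algebra\<^esub> p = \<zero>\<^bsub>free_algebra\<^esub>"
      by (rule bexI[of _ "- p"]) (simp_all add: free_algebra_def)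
  qed (simp_all add: free_algebra_def add.assoc add.commute)
  show "Group.monoid (free_algebra :: ('a free_monoid \<Rightarrow>\<^sub>0 'c) ring)"
    by (rule monoidI) (simp_all add: free_algebra_def mult.assoc)
qed (simp_all add: free_algebra_def distrib_left distrib_right)

text \<open>\<open>bit\<close> is the field with two elements.\<close>

datatype generator = Gen_a | Gen_x

definition ring_aax :: "(generator free_monoid \<Rightarrow>\<^sub>0 bit) set ring"
  where "ring_aax = free_algebra Quot (Idl\<^bsub>free_algebra\<^esub> {free_gen Gen_a - free_gen Gen_a * free_gen Gen_a * free_gen Gen_x})"

lemma ring_ring_aax: "ring ring_aax"
  unfolding ring_aax_def
  by (intro ideal.quotient_is_ring ring.genideal_ideal ring_free_algebra)
    (simp add: free_algebra_def)

definition right_strongly_regular :: "('a, 'b) ring_scheme \<Rightarrow> 'a \<Rightarrow> bool"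
  where "right_strongly_regular S s \<longleftrightarrow> (\<exists>t\<in>carrier S. s = s [^]\<^bsub>S\<^esub> (2::nat) \<otimes>\<^bsub>S\<^esub> t)"

definition left_strongly_regular :: "('a, 'b) ring_scheme \<Rightarrow> 'a \<Rightarrow> bool"
  where "left_strongly_regular S s \<longleftrightarrow> (\<exists>t\<in>carrier S. s = t \<otimes>\<^bsub>S\<^esub> s [^]\<^bsub>S\<^esub> (2::nat))"

definition strongly_regular :: "('a, 'b) ring_scheme \<Rightarrow> 'a \<Rightarrow> bool"
  where "strongly_regular S s \<longleftrightarrow> left_strongly_regular S s \<and> right_strongly_regular S s"

definition left_Dischinger :: "('a, 'b) ring_scheme \<Rightarrow> bool"
  where "left_Dischinger S \<longleftrightarrow>
    (\<forall>s\<in>carrier S. left_strongly_regular S s \<longrightarrow> strongly_regular S s)"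

end

theory Submission
  imports Defs "HOL-Library.Function_Algebras"
begin

text \<open>
  Put \<open>z = 1 - a x\<close> and write \<open>F\<close> for the field with two elements. The relation says \<open>a z = 0\<close> and
  gives \<open>a x = 1 - z\<close>. Hence \<open>x\<close> and \<open>z\<close> generate a free algebra \<open>S\<close> inside \<open>R\<close>, and \<open>R\<close> is a free left
  \<open>S\<close>-module with basis \<open>1, a, a\<^sup>2, \<dots>\<close>: the elements have unique normal forms
  \<open>\<Sum>k. s k * a ^ k\<close>. The theorem rests on two facts.

  \<^item> If \<open>g f = 0\<close> and \<open>f \<noteq> 0\<close>, then \<open>g\<close> lies in \<open>R a\<close>
  (\<open>mult_eq_0_imp_left_factor_in_left_ideal_aa\<close>). Let \<open>A k\<close> be the coefficient of \<open>g x ^ k\<close> at \<open>a ^ 0\<close>.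
  Modulo \<open>R a\<close> one may write \<open>f\<close> as a sum of terms \<open>x ^ k * u k\<close> with \<open>u k\<close> in \<open>F + z S\<close>, and then
  \<open>g f = 0\<close> implies \<open>\<Sum>k. A k * u k = 0\<close>. The \<open>A k\<close> satisfy
  \<open>A (k + 1) = A k * x + s k * (1 - z)\<close> for certain \<open>s k\<close>. A weak division algorithm in \<open>S\<close> shows that such a
  sequence with \<open>A 0 \<noteq> 0\<close> is right independent over \<open>F + z S\<close>
  (\<open>coefficient_sequence_independent\<close>): when each \<open>s k\<close> is replaced by an element of least degree in
  its class modulo the right ideal generated by \<open>A 0 * z, \<dots>, A k * z\<close>, leading forms cannot cancel.
  In particular \<open>R\<close> has no idempotents except \<open>0\<close> and \<open>1\<close>.

  \<^item> If right multiplication by \<open>f\<close> induces a surjective endomorphism of \<open>R / R a ^ n\<close>, then this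
  endomorphism is injective (\<open>surjective_right_mult_injective\<close>), because \<open>R / R a ^ n\<close> is free of finite rank over
  \<open>S\<close>, and \<open>S\<close> is residually finite.

  Both \<open>R f = R f\<^sup>2\<close> and left strong regularity give \<open>f = r f\<^sup>2\<close>, so let \<open>f \<noteq> 0\<close> satisfy this and put
  \<open>g = 1 - r f\<close>. Then \<open>g f = 0\<close>. If \<open>g = 0\<close>, then \<open>f r\<close> is a nonzero idempotent, so \<open>f r = 1\<close> and \<open>f\<close> is a unit. If
  \<open>g \<noteq> 0\<close>, the first fact, applied repeatedly, shows that \<open>a ^ n f = 0\<close> for some \<open>n\<close> and that the left
  annihilator of \<open>f\<close> is \<open>R a ^ n\<close> for the least such \<open>n\<close>. As \<open>r f\<close> is \<open>1\<close> modulo this annihilator, the second fact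
  applies. It shows that \<open>R f\<close> meets the annihilator only in \<open>0\<close>, which makes \<open>g\<close> a nonzero
  idempotent. So \<open>g = 1\<close>, which contradicts \<open>g f = 0\<close> and \<open>f \<noteq> 0\<close>.
\<close>

section \<open>The free algebra over the field with two elements\<close>

text \<open>
  Over the field with two elements an element of the free algebra is the set of its words, and signs
  disappear.
\<close>

lemma free_algebra_char_2: "p + p = (0 :: 'a free_monoid \<Rightarrow>\<^sub>0 bit)"
  by (rule poly_mapping_eqI) (simp add: lookup_add)

lemma free_algebra_uminus: "- p = (p :: 'a free_monoid \<Rightarrow>\<^sub>0 bit)"
  using free_algebra_char_2 by (simp add: neg_eq_iff_add_eq_0)

lemma single_letters_snoc:
  "Poly_Mapping.single (Mon (ls @ [g])) (1::bit) = Poly_Mapping.single (Mon ls) 1 * free_gen g"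
  by (simp add: free_gen_def mult_single plus_free_monoid_def)

lemma single_letters_Cons:
  "Poly_Mapping.single (Mon (g # ls)) (1::bit) = free_gen g * Poly_Mapping.single (Mon ls) 1"
  by (simp add: free_gen_def mult_single plus_free_monoid_def)

lemma free_algebra_word_induct [case_names zero word add]:
  fixes p :: "'a free_monoid \<Rightarrow>\<^sub>0 bit"
  assumes "P 0" and word: "\<And>ls. P (Poly_Mapping.single (Mon ls) 1)" and add: "\<And>p q. P p \<Longrightarrow> P q \<Longrightarrow> P (p + q)"
  shows "P p"
proof (induction p rule: update_induct)
  case const
  then show ?case by fact
next
  case (update f w c)
  have "Poly_Mapping.update w c f = Poly_Mapping.single w c + f"
    using update.hyps(1)
    by (intro poly_mapping_eqI) (auto simp: lookup_update lookup_add lookup_single when_def in_keys_iff)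
  moreover have "c = 1" using update.hyps by simp
  ultimately show ?case using add[OF word[of "letters w"] update.IH] by simp
qed

lemma free_algebra_gen_induct [case_names one gen add]:
  fixes p :: "'a free_monoid \<Rightarrow>\<^sub>0 bit"
  assumes one: "P 1" and gen: "\<And>g p. P p \<Longrightarrow> P (p * free_gen g)" and add: "\<And>p q. P p \<Longrightarrow> P q \<Longrightarrow> P (p + q)"
  shows "P p"
proof (induction p rule: free_algebra_word_induct)
  case zero
  show ?case using add[OF one one] by (simp only: free_algebra_char_2)
next
  case (word ls)
  show ?case
  proof (induction ls rule: rev_induct)
    case Nil
    then show ?case using one by (simp flip: zero_free_monoid_def)
  next
    case (snoc g ls)
    then show ?case using gen by (simp add: single_letters_snoc)
  qed
qed (rule add)

text \<open>
  The universal property of the free algebra, for right modules: additive operators, one for each generator,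
  extend to a right action of the whole algebra on an abelian group of characteristic two. A word acts
  through its letters from left to right, so that \<open>act (p * q) = act q \<circ> act p\<close>.
\<close>

locale free_algebra_action =
  fixes act1 :: "'g \<Rightarrow> 'm \<Rightarrow> 'm::ab_group_add"
  assumes act1_add: "act1 g (m + n) = act1 g m + act1 g n"
    and char_2: "m + m = (0::'m)"
begin

definition word_act :: "'g free_monoid \<Rightarrow> 'm \<Rightarrow> 'm"
  where "word_act w = fold act1 (letters w)"

definition act :: "('g free_monoid \<Rightarrow>\<^sub>0 bit) \<Rightarrow> 'm \<Rightarrow> 'm"
  where "act p m = (\<Sum>w\<in>Poly_Mapping.keys p. word_act w m)"

lemma word_act_add: "word_act w (m + n) = word_act w m + word_act w n"
proof -
  have "fold act1 ls (m + n) = fold act1 ls m + fold act1 ls n" for ls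
    by (induction ls arbitrary: m n) (auto simp: act1_add)
  then show ?thesis by (simp add: word_act_def)
qed

lemma act_right_add: "act p (m + n) = act p m + act p n"
  by (simp add: act_def word_act_add sum.distrib)

lemma act_right_zero [simp]: "act p 0 = 0"
  using act_right_add[of p 0 0] by simp

lemma act_add: "act (p + q) m = act p m + act q m"
proof -
  have act_superset: "act r m = (\<Sum>w\<in>Poly_Mapping.keys p \<union> Poly_Mapping.keys q. if Poly_Mapping.lookup r w = 0 then 0 else word_act w m)"
    if "Poly_Mapping.keys r \<subseteq> Poly_Mapping.keys p \<union> Poly_Mapping.keys q" for r
    unfolding act_def
    using that by (intro sum.mono_neutral_cong_left) (auto simp: in_keys_iff)
  have "act (p + q) m = (\<Sum>w\<in>Poly_Mapping.keys p \<union> Poly_Mapping.keys q. (if Poly_Mapping.lookup p w = 0 then 0 else word_act w m) +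
      (if Poly_Mapping.lookup q w = 0 then 0 else word_act w m))"
    by (subst act_superset[OF Poly_Mapping.keys_add])
      (rule sum.cong, auto simp: lookup_add char_2)
  then show ?thesis
    by (simp add: sum.distrib act_superset)
qed

lemma act_zero [simp]: "act 0 m = 0"
  by (simp add: act_def)

lemma act_single: "act (Poly_Mapping.single w 1) m = word_act w m"
  by (simp add: act_def)

lemma act_one [simp]: "act 1 m = m"
  by (simp add: act_def word_act_def zero_free_monoid_def)

lemma act_gen [simp]: "act (free_gen g) m = act1 g m"
  by (simp add: free_gen_def act_single word_act_def)

lemma act_mult_gen: "act (p * free_gen g) m = act1 g (act p m)"
proof (induction p rule: free_algebra_word_induct)
  case zero
  then show ?case using act_gen[of g 0] by (simp del: act_gen)
next
  case (word ls)
  then show ?case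
    by (simp flip: single_letters_snoc) (simp add: act_single word_act_def)
next
  case (add p q)
  then show ?case by (simp add: distrib_right act_add act1_add)
qed

lemma act_mult: "act (p * q) m = act q (act p m)"
  by (induction q rule: free_algebra_gen_induct)
    (simp_all add: act_mult_gen act_add distrib_left flip: mult.assoc)

lemma act_uminus: "act (- p) m = - act p m"
  using act_add[of p "- p" m] by (simp add: eq_neg_iff_add_eq_0 add.commute)

lemma act_diff: "act (p - q) m = act p m - act q m"
  using act_add[of p "- q" m] by (simp add: act_uminus)

end

section \<open>Degree and right quotients\<close>

definition len :: "'a free_monoid \<Rightarrow> nat"
  where "len w = length (letters w)"

text \<open>
  One more than the degree in the usual sense, and \<open>0\<close> for the zero element; this convention
  saves the case distinctions that a degree \<open>-\<infinity>\<close> of zero would cause.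
\<close>

definition size_deg :: "('a free_monoid \<Rightarrow>\<^sub>0 bit) \<Rightarrow> nat"
  where "size_deg p = Max (insert 0 ((\<lambda>w. Suc (len w)) ` Poly_Mapping.keys p))"

lemma size_deg_le_iff: "size_deg p \<le> n \<longleftrightarrow> (\<forall>w\<in>Poly_Mapping.keys p. len w < n)"
  by (auto simp: size_deg_def Suc_le_eq)

lemma size_deg_eq_0_iff [simp]: "size_deg p = 0 \<longleftrightarrow> p = 0"
  using size_deg_le_iff[of p 0] keys_eq_empty[of p] by auto

lemma size_deg_zero [simp]: "size_deg 0 = 0"
  by simp

lemma size_deg_one [simp]: "size_deg 1 = 1"
  by (simp add: size_deg_def len_def zero_free_monoid_def)

lemma size_deg_add_le: "size_deg p \<le> n \<Longrightarrow> size_deg q \<le> n \<Longrightarrow> size_deg (p + q) \<le> n"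
  using Poly_Mapping.keys_add[of p q] by (auto simp: size_deg_le_iff)

lemma size_deg_uminus [simp]: "size_deg (- p) = size_deg p"
  by (simp add: free_algebra_uminus)

lemma size_deg_diff_le: "size_deg p \<le> n \<Longrightarrow> size_deg q \<le> n \<Longrightarrow> size_deg (p - q) \<le> n"
  using size_deg_add_le[of p n "- q"] by simp

lemma size_deg_sum_le: "(\<And>i. i \<in> A \<Longrightarrow> size_deg (f i) \<le> n) \<Longrightarrow> size_deg (sum f A) \<le> n"
  by (induction A rule: infinite_finite_induct) (auto intro: size_deg_add_le)

definition const_term :: "('a free_monoid \<Rightarrow>\<^sub>0 bit) \<Rightarrow> bit"
  where "const_term p = Poly_Mapping.lookup p 0"

text \<open>
  Every \<open>p\<close> is a constant plus a sum of terms \<open>p\<^sub>c * c\<close> over the letters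
  \<open>c\<close>; the right quotient by \<open>c\<close> is \<open>p\<^sub>c\<close>. Passing to right
  quotients lowers the degree by one and is what replaces the comparison of leading forms in the inductions
  below.
\<close>

definition right_quot :: "'a \<Rightarrow> ('a free_monoid \<Rightarrow>\<^sub>0 bit) \<Rightarrow> ('a free_monoid \<Rightarrow>\<^sub>0 bit)"
  where "right_quot c = Poly_Mapping.map_key (\<lambda>w. w + Mon [c])"

lemma lookup_right_quot: "Poly_Mapping.lookup (right_quot c p) w = Poly_Mapping.lookup p (w + Mon [c])"
proof -
  have "inj (\<lambda>w. w + Mon [c])"
    by (auto simp: inj_def plus_free_monoid_def intro: free_monoid.expand)
  then show ?thesis
    by (simp add: right_quot_def map_key.rep_eq)
qed

lemma right_quot_add [simp]: "right_quot c (p + q) = right_quot c p + right_quot c q"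
  by (rule poly_mapping_eqI) (simp add: lookup_right_quot lookup_add)

lemma right_quot_zero [simp]: "right_quot c 0 = 0"
  by (rule poly_mapping_eqI) (simp add: lookup_right_quot)

lemma right_quot_one [simp]: "right_quot c 1 = 0"
  by (rule poly_mapping_eqI)
    (simp add: lookup_right_quot lookup_one when_def plus_free_monoid_def zero_free_monoid_def)

lemma right_quot_diff [simp]: "right_quot c (p - q) = right_quot c p - right_quot c q"
  by (rule poly_mapping_eqI) (simp add: lookup_right_quot lookup_minus)

lemma right_quot_sum: "right_quot c (sum f A) = (\<Sum>i\<in>A. right_quot c (f i))"
  by (induction A rule: infinite_finite_induct) auto

lemma right_quot_mult_gen: "right_quot c (p * free_gen g) = (if g = c then p else 0)"
proof (induction p rule: free_algebra_word_induct)
  case (word ls)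
  show ?case
    by (rule poly_mapping_eqI)
      (auto simp: lookup_right_quot lookup_single when_def plus_free_monoid_def free_monoid.expand
        simp flip: single_letters_snoc)
qed (auto simp: distrib_right)

lemma right_quot_gen [simp]: "right_quot c (free_gen g) = (if g = c then 1 else 0)"
  using right_quot_mult_gen[of c 1 g] by simp

lemma const_term_add [simp]: "const_term (p + q) = const_term p + const_term q"
  by (simp add: const_term_def lookup_add)

lemma const_term_zero [simp]: "const_term 0 = 0"
  by (simp add: const_term_def)

lemma const_term_one [simp]: "const_term 1 = 1"
  by (simp add: const_term_def lookup_one)

lemma const_term_mult_gen [simp]: "const_term (p * free_gen g) = 0"
proof (induction p rule: free_algebra_word_induct)
  case (word ls)
  then show ?case
    by (simp add: const_term_def lookup_single zero_free_monoid_def flip: single_letters_snoc)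
qed (auto simp: distrib_right)

lemma size_deg_right_quot: "size_deg (right_quot c p) \<le> size_deg p - 1"
proof -
  have "len w < size_deg p - 1" if "w \<in> Poly_Mapping.keys (right_quot c p)" for w
  proof -
    have "w + Mon [c] \<in> Poly_Mapping.keys p"
      using that by (simp add: in_keys_iff lookup_right_quot)
    then have "len (w + Mon [c]) < size_deg p"
      using size_deg_le_iff by blast
    then show ?thesis by (simp add: len_def plus_free_monoid_def)
  qed
  then show ?thesis by (simp add: size_deg_le_iff)
qed

lemma size_deg_le_right_quots:
  assumes "\<And>c. size_deg (right_quot c p) \<le> n"
  shows "size_deg p \<le> Suc n"
  unfolding size_deg_le_iff
proof
  fix w assume w: "w \<in> Poly_Mapping.keys p"
  show "len w < Suc n"
  proof (cases "letters w" rule: rev_cases)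
    case (snoc ls c)
    then have "w = Mon ls + Mon [c]"
      by (simp add: plus_free_monoid_def free_monoid.expand)
    then have "Mon ls \<in> Poly_Mapping.keys (right_quot c p)"
      using w by (simp add: in_keys_iff lookup_right_quot)
    then have "len (Mon ls) < n"
      using assms size_deg_le_iff by blast
    then show ?thesis using snoc by (simp add: len_def)
  qed (simp add: len_def)
qed

text \<open>
  A twisted Leibniz rule: a word of \<open>p * u\<close> takes its last letter from \<open>u\<close>, unless
  the factor coming from \<open>u\<close> is the empty word.
\<close>

lemma right_quot_mult:
  "right_quot c (p * u) = p * right_quot c u + (if const_term u = 0 then 0 else right_quot c p)"
proof (induction u rule: free_algebra_gen_induct)
  case (gen g u)
  then show ?case by (simp add: right_quot_mult_gen flip: mult.assoc)
next
  case (add u v)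
  then show ?case by (auto simp: distrib_left free_algebra_char_2 algebra_simps)
qed auto

section \<open>Right independence of the sequence of coefficients\<close>

text \<open>
  The letters generate the free algebra \<open>S\<close> over which the ring of the theorem is free as a
  left module; \<open>Letter_z\<close> is going to be \<open>1 - a * x\<close>.
\<close>

datatype letter = Letter_x | Letter_z

instance letter :: finite
proof
  have "(UNIV :: letter set) \<subseteq> {Letter_x, Letter_z}" using letter.exhaust by blast
  then show "finite (UNIV :: letter set)" by (rule finite_subset) simp
qed

type_synonym free_xz = "letter free_monoid \<Rightarrow>\<^sub>0 bit"

abbreviation gen_x :: free_xz where "gen_x \<equiv> free_gen Letter_x"
abbreviation gen_z :: free_xz where "gen_z \<equiv> free_gen Letter_z"

lemma size_deg_pos: "p \<noteq> 0 \<Longrightarrow> 1 \<le> size_deg p"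
  by (metis size_deg_eq_0_iff less_one not_le)

lemma const_term_gen [simp]: "const_term (free_gen g) = 0"
  using const_term_mult_gen[of 1 g] by simp

lemma const_term_mult [simp]: "const_term (p * q) = const_term p * const_term q"
  by (induction q rule: free_algebra_gen_induct) (simp_all add: distrib_left flip: mult.assoc)

lemma size_deg_le_1:
  assumes "size_deg u \<le> 1"
  shows "u = 0 \<or> u = 1"
proof -
  have "u = Poly_Mapping.single 0 (const_term u)"
  proof (rule poly_mapping_eqI)
    fix w
    have "w = 0" if "w \<in> Poly_Mapping.keys u"
      using assms that by (auto simp: size_deg_le_iff len_def zero_free_monoid_def free_monoid.expand)
    then have "Poly_Mapping.lookup u w = 0" if "w \<noteq> 0"
      using that by (metis in_keys_iff)
    then show "Poly_Mapping.lookup u w = Poly_Mapping.lookup (Poly_Mapping.single 0 (const_term u)) w"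
      by (auto simp: const_term_def lookup_single when_def simp del: bit_not_zero_iff)
  qed
  then show ?thesis by (cases "const_term u") auto
qed

text \<open>
  The degree of a product is at least the sum of the degrees; by induction on the second factor, taking a
  right quotient that keeps its degree as large as possible.
\<close>

lemma size_deg_mult_ge:
  assumes "p \<noteq> 0" "u \<noteq> 0"
  shows "size_deg p + size_deg u \<le> Suc (size_deg (p * u))"
  using assms(2)
proof (induction "size_deg u" arbitrary: u rule: less_induct)
  case less
  show ?case
  proof (cases "size_deg u \<le> 1")
    case True
    then have "u = 1" using size_deg_le_1 less.prems by blast
    then show ?thesis by simp
  next
    case False
    obtain c where c: "size_deg u - 1 \<le> size_deg (right_quot c u)"
    proof (rule ccontr)
      assume *: "\<not> thesis"
      have "\<And>c. size_deg (right_quot c u) \<le> size_deg u - 2"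
      proof -
        fix c
        have "\<not> size_deg u - 1 \<le> size_deg (right_quot c u)" using * that by blast
        then show "size_deg (right_quot c u) \<le> size_deg u - 2" by simp
      qed
      then have "size_deg u \<le> Suc (size_deg u - 2)" by (rule size_deg_le_right_quots)
      then show False using False by simp
    qed
    let ?r = "right_quot c u"
    have ne: "?r \<noteq> 0" using c False by auto
    then have pos: "1 \<le> size_deg ?r" by (rule size_deg_pos)
    have "size_deg ?r < size_deg u"
      using size_deg_right_quot[of c u] False by simp
    then have IH: "size_deg p + size_deg ?r \<le> Suc (size_deg (p * ?r))"
      using less.hyps ne by blast
    have p: "1 \<le> size_deg p" using assms(1) by (rule size_deg_pos)
    have "p * ?r = right_quot c (p * u) - (if const_term u = 0 then 0 else right_quot c p)"
      by (simp add: right_quot_mult)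
    also have "size_deg \<dots> \<le> max (size_deg (right_quot c (p * u))) (size_deg p - 1)"
      using size_deg_right_quot[of c p] by (intro size_deg_diff_le) auto
    finally show ?thesis
      using IH pos p c size_deg_right_quot[of c "p * u"] by (auto simp: max_def split: if_splits)
  qed
qed

text \<open>
  The subspace \<open>F + z S\<close> of \<open>S\<close>. Every element of \<open>S\<close> is a sum of
  terms \<open>x ^ k * u k\<close> with \<open>u k\<close> in this subspace, and right quotients do not lead
  out of it; the right quotient by \<open>x\<close> even lies in \<open>z S\<close>.
\<close>

definition const_plus_z :: "free_xz set"
  where "const_plus_z = {u. \<exists>q. u = gen_z * q \<or> u = 1 + gen_z * q}"

lemma z_mult_in_const_plus_z: "gen_z * q \<in> const_plus_z"
  by (auto simp: const_plus_z_def)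

lemma one_plus_z_mult_in_const_plus_z: "1 + gen_z * q \<in> const_plus_z"
  by (auto simp: const_plus_z_def)

lemma zero_in_const_plus_z: "0 \<in> const_plus_z"
  using z_mult_in_const_plus_z[of 0] by simp

lemma one_in_const_plus_z: "1 \<in> const_plus_z"
  using one_plus_z_mult_in_const_plus_z[of 0] by simp

lemma add_z_mult_in_const_plus_z: "u \<in> const_plus_z \<Longrightarrow> u + gen_z * q \<in> const_plus_z"
  by (auto simp: const_plus_z_def add.assoc simp flip: distrib_left)

lemma add_one_in_const_plus_z:
  assumes "u \<in> const_plus_z"
  shows "u + 1 \<in> const_plus_z"
proof -
  from assms obtain q where "u = gen_z * q \<or> u = 1 + gen_z * q"
    by (auto simp: const_plus_z_def)
  moreover have "1 + gen_z * q + 1 = gen_z * q"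
    using free_algebra_char_2[of "1 :: free_xz"] by (simp add: algebra_simps)
  ultimately show ?thesis
    using z_mult_in_const_plus_z one_plus_z_mult_in_const_plus_z by (metis add.commute)
qed

lemma add_in_const_plus_z: "u \<in> const_plus_z \<Longrightarrow> v \<in> const_plus_z \<Longrightarrow> u + v \<in> const_plus_z"
proof -
  assume u: "u \<in> const_plus_z" and "v \<in> const_plus_z"
  then obtain q where "v = gen_z * q \<or> v = 1 + gen_z * q"
    by (auto simp: const_plus_z_def)
  moreover have "u + (1 + gen_z * q) = (u + 1) + gen_z * q"
    by (simp add: add.assoc)
  ultimately show ?thesis
    using u add_one_in_const_plus_z add_z_mult_in_const_plus_z by metis
qed

lemma right_quot_x_const_plus_z: "u \<in> const_plus_z \<Longrightarrow> \<exists>q. right_quot Letter_x u = gen_z * q"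
  by (auto simp: const_plus_z_def right_quot_mult)

lemma right_quot_z_const_plus_z: "u \<in> const_plus_z \<Longrightarrow> right_quot Letter_z u \<in> const_plus_z"
  by (auto simp: const_plus_z_def right_quot_mult add.commute)

lemma right_quot_const_plus_z: "u \<in> const_plus_z \<Longrightarrow> right_quot c u \<in> const_plus_z"
  using right_quot_x_const_plus_z[of u] right_quot_z_const_plus_z[of u] z_mult_in_const_plus_z
  by (cases c) auto

text \<open>
  Right independence of \<open>b 0, \<dots>, b (n - 1)\<close> over \<open>F + z S\<close> in a strong form:
  the leading forms of the terms \<open>b k * u k\<close> never cancel.
\<close>

definition deg_independent :: "nat \<Rightarrow> (nat \<Rightarrow> free_xz) \<Rightarrow> bool"
  where "deg_independent n b \<longleftrightarrow> (\<forall>u. (\<forall>k<n. u k \<in> const_plus_z) \<longrightarrow>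
    (\<forall>k<n. u k \<noteq> 0 \<longrightarrow> size_deg (b k) + size_deg (u k) \<le> Suc (size_deg (\<Sum>k<n. b k * u k))))"

text \<open>
  The induction step behind the independence. The elements are listed by increasing degree. A cancellation
  of leading forms in a degree above that of \<open>b (Suc l)\<close> passes to a right quotient, where the
  degree is smaller, and in a degree below it only the earlier elements can take part. So it remains to
  exclude that the leading form of \<open>b (Suc l)\<close> is a combination of the earlier ones. If it
  contains \<open>b l * x\<close>, then the right quotient by \<open>x\<close> gives such a cancellation
  among the earlier elements; otherwise it is the leading form of \<open>- s * z\<close>, and the right
  quotient by \<open>z\<close> shows that the degree of \<open>s\<close> can be lowered by adding an element
  of the right ideal generated by the \<open>b k * z\<close>, which the minimality of \<open>s\<close>
  forbids.
\<close>

lemma deg_independent_Suc: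
  assumes indep: "deg_independent (Suc l) b"
    and nz: "b l \<noteq> 0"
    and incr: "\<And>k. k \<le> l \<Longrightarrow> size_deg (b k) \<le> size_deg (b l)"
    and s_minimal: "\<And>q. size_deg s \<le> size_deg (s + (\<Sum>k<Suc l. b k * (gen_z * q k)))"
    and b_Suc: "b (Suc l) = b l * gen_x + s * (1 - gen_z)"
  shows "size_deg (b l) < size_deg (b (Suc l))" and "deg_independent (Suc (Suc l)) b"
proof -
  let ?L = "Suc l" and ?D = "size_deg (b (Suc l))"
  have quot_x: "right_quot Letter_x (b ?L) = b l + right_quot Letter_x s"
    by (simp add: b_Suc right_quot_mult_gen right_diff_distrib)
  have quot_z: "right_quot Letter_z (b ?L) = right_quot Letter_z s - s"
    by (simp add: b_Suc right_quot_mult_gen right_diff_distrib)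
  have bl_pos: "1 \<le> size_deg (b l)"
    using nz by (rule size_deg_pos)
  have quot_le: "size_deg (right_quot c p) \<le> n" if "size_deg p \<le> Suc n" for c n and p :: free_xz
    using size_deg_right_quot[of c p] that by simp
  have D: "?D = Suc (max (size_deg (b l)) (size_deg s))"
  proof (rule antisym)
    have "size_deg (right_quot c (b ?L)) \<le> max (size_deg (b l)) (size_deg s)" for c
      by (cases c) (auto simp: quot_x quot_z intro!: size_deg_add_le size_deg_diff_le quot_le)
    then show "?D \<le> Suc (max (size_deg (b l)) (size_deg s))"
      by (rule size_deg_le_right_quots)
    have "size_deg (b l) \<le> max (size_deg (right_quot Letter_x (b ?L))) (size_deg s - 1)"
    proof -
      have "b l = right_quot Letter_x (b ?L) - right_quot Letter_x s" by (simp add: quot_x)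
      also have "size_deg \<dots> \<le> max (size_deg (right_quot Letter_x (b ?L))) (size_deg s - 1)"
        using size_deg_right_quot[of Letter_x s] by (intro size_deg_diff_le) auto
      finally show ?thesis .
    qed
    moreover have "size_deg s \<le> max (size_deg (right_quot Letter_z (b ?L))) (size_deg s - 1)"
    proof -
      have "s = right_quot Letter_z s - right_quot Letter_z (b ?L)" by (simp add: quot_z)
      also have "size_deg \<dots> \<le> max (size_deg (right_quot Letter_z (b ?L))) (size_deg s - 1)"
        using size_deg_right_quot[of Letter_z s] by (intro size_deg_diff_le) auto
      finally show ?thesis .
    qed
    ultimately show "Suc (max (size_deg (b l)) (size_deg s)) \<le> ?D"
      using size_deg_right_quot[of Letter_x "b ?L"] size_deg_right_quot[of Letter_z "b ?L"] bl_pos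
      by (auto simp: max_def split: if_splits)
  qed
  show less: "size_deg (b l) < ?D" using D by simp
  have b_le_D: "size_deg (b k) \<le> ?D" if "k < Suc ?L" for k
    using incr[of k] less that by (cases "k = ?L") auto
  have quot_sum: "right_quot c (\<Sum>k<n. b k * u k) = (\<Sum>k<n. b k * right_quot c (u k)) +
      (\<Sum>k<n. if const_term (u k) = 0 then 0 else right_quot c (b k))" for c n u
    by (simp add: right_quot_sum right_quot_mult sum.distrib)
  \<comment> \<open>If \<open>Suc m\<close> bounds the size of all terms and the sum is smaller, then no term attains the
    bound.\<close>
  have drop: "\<forall>k<Suc ?L. u k \<noteq> 0 \<longrightarrow> size_deg (b k) + size_deg (u k) \<le> Suc m"
    if "\<forall>k<Suc ?L. u k \<in> const_plus_z"
      and "\<forall>k<Suc ?L. u k \<noteq> 0 \<longrightarrow> size_deg (b k) + size_deg (u k) \<le> Suc (Suc m)"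
      and "size_deg (\<Sum>k<Suc ?L. b k * u k) \<le> m" for m u
    using that
  proof (induction m arbitrary: u rule: less_induct)
    case (less m)
    let ?e = "\<Sum>k<Suc ?L. b k * u k"
    consider (low) "?D \<le> m" | (high) "?D > Suc m \<or> u ?L = 0" | (eq) "?D = Suc m" "u ?L \<noteq> 0"
      by linarith
    then show ?case
    proof cases
      \<comment> \<open>The degrees of all \<open>b k\<close> are below the critical one, so the constants in the
        \<open>u k\<close> do not matter and both right quotients inherit the cancellation.\<close>
      case low
      then obtain m' where m: "m = Suc m'" using less D by (cases m) auto
      have quot: "\<forall>k<Suc ?L. right_quot c (u k) \<noteq> 0 \<longrightarrow> size_deg (b k) + size_deg (right_quot c (u k)) \<le> m" for c
      proof -
        have "(\<Sum>k<Suc ?L. b k * right_quot c (u k)) = right_quot c ?e -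
            (\<Sum>k<Suc ?L. if const_term (u k) = 0 then 0 else right_quot c (b k))"
          unfolding quot_sum by simp
        also have "size_deg \<dots> \<le> m'"
        proof (intro size_deg_diff_le size_deg_sum_le)
          show "size_deg (right_quot c ?e) \<le> m'"
            using less.prems(3) m by (intro quot_le) simp
          fix k assume "k \<in> {..<Suc ?L}"
          then show "size_deg (if const_term (u k) = 0 then 0 else right_quot c (b k)) \<le> m'"
            using b_le_D[of k] low m by (auto intro: quot_le)
        qed
        finally have small: "size_deg (\<Sum>k<Suc ?L. b k * right_quot c (u k)) \<le> m'" .
        have "size_deg (b k) + size_deg (right_quot c (u k)) \<le> Suc (Suc m')"
          if "k < Suc ?L" "right_quot c (u k) \<noteq> 0" for k
        proof -
          have "1 \<le> size_deg (right_quot c (u k))" using that(2) by (rule size_deg_pos)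
          moreover have "u k \<noteq> 0" using that(2) by auto
          ultimately show ?thesis
            using less.prems(2)[rule_format, OF that(1)] m size_deg_right_quot[of c "u k"] by linarith
        qed
        then show ?thesis
          using less.IH[of m' "\<lambda>k. right_quot c (u k)"] less.prems(1) m small
          by (auto intro: right_quot_const_plus_z)
      qed
      show ?thesis
      proof (intro allI impI)
        fix k assume k: "k < Suc ?L" "u k \<noteq> 0"
        have b: "size_deg (b k) \<le> m" using b_le_D[OF k(1)] low by simp
        have "size_deg (right_quot c (u k)) \<le> m - size_deg (b k)" for c
        proof (cases "right_quot c (u k) = 0")
          case False
          then have "size_deg (b k) + size_deg (right_quot c (u k)) \<le> m" using quot k(1) by blast
          then show ?thesis by simp
        qed simp
        then have "size_deg (u k) \<le> Suc (m - size_deg (b k))" by (rule size_deg_le_right_quots)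
        then show "size_deg (b k) + size_deg (u k) \<le> Suc m" using b by simp
      qed
    next
      \<comment> \<open>The last coefficient has to vanish, and the earlier elements are independent.\<close>
      case high
      have uL: "u ?L = 0"
      proof (rule ccontr)
        assume ne: "u ?L \<noteq> 0"
        then have "1 \<le> size_deg (u ?L)" by (rule size_deg_pos)
        moreover have "?D + size_deg (u ?L) \<le> Suc (Suc m)" using less.prems(2) ne by blast
        ultimately show False using high ne by simp
      qed
      then have "?e = (\<Sum>k<?L. b k * u k)" by simp
      then have "\<forall>k<?L. u k \<noteq> 0 \<longrightarrow> size_deg (b k) + size_deg (u k) \<le> Suc (size_deg ?e)"
        using indep less.prems(1) by (auto simp: deg_independent_def)
      then show ?thesis
        using less.prems(3) uL by (auto simp: less_Suc_eq intro: order_trans)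
    next
      case eq
      have "?D + size_deg (u ?L) \<le> Suc (Suc m)" using less.prems(2) eq(2) by blast
      then have "size_deg (u ?L) \<le> 1" using eq(1) by simp
      then have uL: "u ?L = 1" using size_deg_le_1 eq(2) by blast
      then have e: "?e = (\<Sum>k<?L. b k * u k) + b ?L" by simp
      have U: "u k \<in> const_plus_z" if "k < ?L" for k using less.prems(1) that by simp
      have "m \<ge> 1" using eq(1) D bl_pos by simp
      then obtain m' where m: "m = Suc m'" by (cases m) auto
      have quot_e: "size_deg (right_quot c ?e) \<le> m'" for c
        using less.prems(3) m by (intro quot_le) simp
      have bl_m: "size_deg (b l) \<le> m" "size_deg s \<le> m" using eq(1) D by auto
      have const_quots: "size_deg (\<Sum>k<?L. if const_term (u k) = 0 then 0 else right_quot c (b k)) \<le> m'" for c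
      proof (rule size_deg_sum_le)
        fix k assume "k \<in> {..<?L}"
        then have "size_deg (b k) \<le> Suc m'" using incr[of k] bl_m m by simp
        then show "size_deg (if const_term (u k) = 0 then 0 else right_quot c (b k)) \<le> m'"
          by (simp add: quot_le)
      qed
      have False
      proof (cases "size_deg s \<le> size_deg (b l)")
        case True
        then have bl: "size_deg (b l) = m" using eq(1) D by simp
        \<comment> \<open>The right quotient by \<open>x\<close> turns the relation into one between the earlier elements in
          which \<open>b l\<close> has a coefficient with constant term 1.\<close>
        define v where "v k = right_quot Letter_x (u k) + (if k = l then 1 else 0)" for k
        have "(\<Sum>k<?L. b k * v k) = (\<Sum>k<?L. b k * right_quot Letter_x (u k)) + b l"
          by (simp add: v_def distrib_left sum.distrib add.assoc)
        also have "\<dots> = right_quot Letter_x ?e - right_quot Letter_x s -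
            (\<Sum>k<?L. if const_term (u k) = 0 then 0 else right_quot Letter_x (b k))"
          unfolding e right_quot_add quot_sum quot_x by simp
        also have "size_deg \<dots> \<le> m'"
          using bl_m m by (intro size_deg_diff_le quot_e const_quots quot_le[of s]) simp
        finally have "size_deg (\<Sum>k<?L. b k * v k) \<le> m'" .
        moreover have "v k \<in> const_plus_z" if "k < ?L" for k
          using right_quot_const_plus_z[OF U[OF that]] add_one_in_const_plus_z by (auto simp: v_def)
        moreover have "v l \<noteq> 0"
        proof
          assume v0: "v l = 0"
          obtain q where q: "right_quot Letter_x (u l) = gen_z * q"
            using right_quot_x_const_plus_z[OF U[of l]] by auto
          have "const_term (v l) = 1" by (simp add: v_def q)
          then show False using v0 by simp
        qed
        ultimately have "size_deg (b l) + size_deg (v l) \<le> Suc m'"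
          using indep[unfolded deg_independent_def, rule_format, of v l] by simp
        moreover have "1 \<le> size_deg (v l)" using \<open>v l \<noteq> 0\<close> by (rule size_deg_pos)
        ultimately show False using bl m by simp
      next
        case False
        then have s: "size_deg s = m" "size_deg (b l) \<le> m'" using eq(1) D m by auto
        \<comment> \<open>The right quotient by \<open>z\<close> contradicts the minimality of \<open>s\<close>; the
          constants in the quotients of the \<open>u k\<close> contribute only multiples of the
          \<open>b k\<close>, whose degree is below that of \<open>s\<close>.\<close>
        have "\<exists>q c. right_quot Letter_z (u k) = gen_z * q + (if c then 1 else 0)" if "k < ?L" for k
        proof -
          have "right_quot Letter_z (u k) \<in> const_plus_z" using U[OF that] by (rule right_quot_z_const_plus_z)
          then obtain q where "right_quot Letter_z (u k) = gen_z * q + (if False then 1 else 0) \<or>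
              right_quot Letter_z (u k) = gen_z * q + (if True then 1 else 0)"
            by (auto simp: const_plus_z_def add.commute)
          then show ?thesis by blast
        qed
        then obtain q c where qc:
          "\<And>k. k < ?L \<Longrightarrow> right_quot Letter_z (u k) = gen_z * q k + (if c k then 1 else 0)"
          by metis
        have "(\<Sum>k<?L. b k * right_quot Letter_z (u k)) =
            (\<Sum>k<?L. b k * (gen_z * q k) + (if c k then b k else 0))"
          by (rule sum.cong) (auto simp: qc distrib_left)
        then have sum_q: "(\<Sum>k<?L. b k * right_quot Letter_z (u k)) =
            (\<Sum>k<?L. b k * (gen_z * q k)) + (\<Sum>k<?L. if c k then b k else 0)"
          by (simp only: sum.distrib)
        have "(\<Sum>k<?L. b k * (gen_z * q k)) - s = right_quot Letter_z ?e - right_quot Letter_z s -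
            (\<Sum>k<?L. if const_term (u k) = 0 then 0 else right_quot Letter_z (b k)) -
            (\<Sum>k<?L. if c k then b k else 0)"
          unfolding e right_quot_add quot_sum quot_z sum_q by simp
        also have "size_deg \<dots> \<le> m'"
        proof (intro size_deg_diff_le)
          show "size_deg (\<Sum>k<?L. if c k then b k else 0) \<le> m'"
          proof (rule size_deg_sum_le)
            fix k assume "k \<in> {..<?L}"
            then show "size_deg (if c k then b k else 0) \<le> m'" using incr[of k] s(2) by simp
          qed
        qed (use bl_m m in \<open>auto intro: quot_e const_quots quot_le simp del: sum.lessThan_Suc\<close>)
        finally have "size_deg ((\<Sum>k<?L. b k * (gen_z * q k)) - s) \<le> m'" .
        then have "size_deg (s + (\<Sum>k<?L. b k * (gen_z * q k))) \<le> m'"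
          by (metis add_uminus_conv_diff add.commute free_algebra_uminus)
        then show False using s_minimal[of q] s m by simp
      qed
      then show ?thesis ..
    qed
  qed
  show "deg_independent (Suc (Suc l)) b"
    unfolding deg_independent_def
  proof (intro allI impI)
    fix u k assume U: "\<forall>k<Suc ?L. u k \<in> const_plus_z" and k: "k < Suc ?L" "u k \<noteq> 0"
    let ?e = "\<Sum>k<Suc ?L. b k * u k"
    let ?P = "\<lambda>n. \<forall>k<Suc ?L. u k \<noteq> 0 \<longrightarrow> size_deg (b k) + size_deg (u k) \<le> Suc n"
    have "?P (\<Sum>k<Suc ?L. size_deg (b k) + size_deg (u k))"
      by (auto intro!: le_SucI member_le_sum[of _ _ "\<lambda>k. size_deg (b k) + size_deg (u k)"] simp del: sum.lessThan_Suc)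
    then have "?P (size_deg ?e + n) \<Longrightarrow> ?P (size_deg ?e)" for n
    proof (induction n)
      case (Suc n)
      then show ?case using drop[OF U, of "size_deg ?e + n"] by simp
    qed simp
    moreover have "?P (size_deg ?e + (\<Sum>k<Suc ?L. size_deg (b k) + size_deg (u k)))"
      using \<open>?P (\<Sum>k<Suc ?L. size_deg (b k) + size_deg (u k))\<close>
      by (meson Suc_le_mono le_add2 order_trans)
    ultimately show "size_deg (b k) + size_deg (u k) \<le> Suc (size_deg ?e)" using k by blast
  qed
qed

lemma deg_independent_cong: "(\<And>k. k < n \<Longrightarrow> b k = c k) \<Longrightarrow> deg_independent n b \<longleftrightarrow> deg_independent n c"
  unfolding deg_independent_def by (simp cong: sum.cong_simp)

text \<open>
  A sequence satisfying the recursion need not itself have independent leading forms. Changing each summand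
  \<open>s l\<close> modulo the right ideal generated by the earlier \<open>b k * z\<close>, so that its
  degree becomes minimal, is a unitriangular change with off-diagonal entries in \<open>z S\<close> and
  leads to a sequence with that property.
\<close>

lemma reduced_sequence_exists:
  fixes a s :: "nat \<Rightarrow> free_xz"
  assumes "a 0 \<noteq> 0" and a_Suc: "\<And>l. a (Suc l) = a l * gen_x + s l * (1 - gen_z)"
  shows "\<exists>b. deg_independent (Suc l) b \<and> (\<forall>k\<le>l. b k \<noteq> 0 \<and> size_deg (b k) \<le> size_deg (b l)) \<and>
    (\<forall>k\<le>l. \<exists>q. a k = b k + (\<Sum>j<k. b j * (gen_z * q j)))"
proof (induction l)
  case 0
  have "deg_independent (Suc 0) a"
    using size_deg_mult_ge[OF assms(1)] by (simp add: deg_independent_def)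
  then show ?case using assms(1) by (intro exI[of _ a]) simp
next
  case (Suc l)
  then obtain b where indep: "deg_independent (Suc l) b"
    and b: "\<And>k. k \<le> l \<Longrightarrow> b k \<noteq> 0" "\<And>k. k \<le> l \<Longrightarrow> size_deg (b k) \<le> size_deg (b l)"
    and a: "\<And>k. k \<le> l \<Longrightarrow> \<exists>q. a k = b k + (\<Sum>j<k. b j * (gen_z * q j))"
    by blast
  define m where "m r = s l + (\<Sum>k<Suc l. b k * (gen_z * r k))" for r
  obtain r where r: "\<And>r'. size_deg (m r) \<le> size_deg (m r')"
    using ex_has_least_nat[of "\<lambda>_. True" _ "\<lambda>r. size_deg (m r)"] by blast
  define c where "c = b(Suc l := b l * gen_x + m r * (1 - gen_z))"
  have c_b: "c k = b k" if "k < Suc l" for k using that by (simp add: c_def)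
  have c_Suc: "c (Suc l) = c l * gen_x + m r * (1 - gen_z)" by (simp add: c_def)
  have indep_c: "deg_independent (Suc l) c"
    using indep c_b deg_independent_cong[of "Suc l" c b] by blast
  have "size_deg (m r) \<le> size_deg (m r + (\<Sum>k<Suc l. c k * (gen_z * q k)))" for q
  proof -
    have "m r + (\<Sum>k<Suc l. c k * (gen_z * q k)) = m (\<lambda>k. r k + q k)"
      unfolding m_def by (simp add: c_b distrib_left sum.distrib add_ac cong: sum.cong_simp)
    then show ?thesis using r by simp
  qed
  note step = deg_independent_Suc[OF indep_c _ _ this c_Suc]
  have less: "size_deg (c l) < size_deg (c (Suc l))" and indep': "deg_independent (Suc (Suc l)) c"
    using step b c_b by auto
  have "c (Suc l) \<noteq> 0" using less by auto
  then have nz: "\<forall>k\<le>Suc l. c k \<noteq> 0 \<and> size_deg (c k) \<le> size_deg (c (Suc l))"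
    using b less c_b by (fastforce simp: le_Suc_eq intro: order_trans less_imp_le)
  have "\<exists>q. a k = c k + (\<Sum>j<k. c j * (gen_z * q j))" if "k \<le> Suc l" for k
  proof (cases "k = Suc l")
    case False
    then show ?thesis using a[of k] that c_b by (simp cong: sum.cong_simp)
  next
    case True
    obtain q where q: "a l = b l + (\<Sum>j<l. b j * (gen_z * q j))" using a by blast
    define q' where "q' j = (if j < l then q j * gen_x else 0) - r j * (1 - gen_z)" for j
    have "(\<Sum>j<Suc l. c j * (gen_z * q' j)) =
        (\<Sum>j<Suc l. b j * (gen_z * (if j < l then q j * gen_x else 0)) - b j * (gen_z * r j) * (1 - gen_z))"
      by (rule sum.cong) (auto simp: c_b q'_def algebra_simps)
    also have "\<dots> = (\<Sum>j<l. b j * (gen_z * q j)) * gen_x - (\<Sum>j<Suc l. b j * (gen_z * r j)) * (1 - gen_z)"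
      by (simp add: sum_subtractf sum_distrib_right mult.assoc distrib_right)
    also have "\<dots> = (a l - b l) * gen_x - (m r - s l) * (1 - gen_z)"
      by (simp add: q m_def)
    also have "\<dots> = a (Suc l) - c (Suc l)"
      by (simp add: a_Suc c_Suc c_b algebra_simps)
    finally show ?thesis using True by (intro exI[of _ q']) simp
  qed
  then show ?case using indep' nz by blast
qed

text \<open>
  Since \<open>F + z S\<close> absorbs the entries of the unitriangular change, a relation for
  \<open>a\<close> becomes one for the reduced sequence \<open>b\<close> with the same last coefficient,
  which therefore vanishes.
\<close>

lemma coefficient_sequence_independent:
  fixes a s u :: "nat \<Rightarrow> free_xz"
  assumes a: "a 0 \<noteq> 0" "\<And>l. a (Suc l) = a l * gen_x + s l * (1 - gen_z)"
    and u: "\<And>k. u k \<in> const_plus_z" and sum: "(\<Sum>k<n. a k * u k) = 0" and "k < n"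
  shows "u k = 0"
  using sum \<open>k < n\<close>
proof (induction n)
  case (Suc l)
  obtain b where indep: "deg_independent (Suc l) b" and nz: "b l \<noteq> 0"
    and b: "\<And>k. k \<le> l \<Longrightarrow> \<exists>q. a k = b k + (\<Sum>j<k. b j * (gen_z * q j))"
    using reduced_sequence_exists[OF a, of l] by blast
  have "\<exists>v. (\<forall>k. v k \<in> const_plus_z) \<and> (\<Sum>k<n. a k * u k) = (\<Sum>k<n. b k * v k) \<and>
      (\<forall>j. n = Suc j \<longrightarrow> v j = u j)" if "n \<le> Suc l" for n
    using that
  proof (induction n)
    case 0
    then show ?case using u by auto
  next
    case (Suc n)
    then obtain v where v: "\<And>k. v k \<in> const_plus_z" "(\<Sum>k<n. a k * u k) = (\<Sum>k<n. b k * v k)" by auto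
    obtain q where q: "a n = b n + (\<Sum>j<n. b j * (gen_z * q j))" using b Suc.prems by force
    define v' where "v' k = (if k < n then v k + gen_z * (q k * u n) else u n)" for k
    have "v' k \<in> const_plus_z" for k
      using u v(1) add_z_mult_in_const_plus_z by (simp add: v'_def)
    moreover have "(\<Sum>k<Suc n. a k * u k) = (\<Sum>k<Suc n. b k * v' k)"
      by (simp add: v'_def q v(2) distrib_left distrib_right sum.distrib sum_distrib_right mult.assoc)
    moreover have "v' n = u n" by (simp add: v'_def)
    ultimately show ?case by blast
  qed
  then obtain v where v: "\<And>k. v k \<in> const_plus_z" "v l = u l"
      "(\<Sum>k<Suc l. a k * u k) = (\<Sum>k<Suc l. b k * v k)"
    by blast
  have "v l \<noteq> 0 \<longrightarrow> size_deg (b l) + size_deg (v l) \<le> Suc 0"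
    using indep v Suc.prems(1) unfolding deg_independent_def by (metis lessI size_deg_zero)
  then have "u l = 0"
    using size_deg_pos[OF nz] size_deg_pos[of "u l"] v(2) by force
  then show ?case using Suc by (cases "k = l") auto
qed simp

section \<open>The ring and its normal form\<close>

definition aax_relator :: "generator free_monoid \<Rightarrow>\<^sub>0 bit"
  where "aax_relator = free_gen Gen_a - free_gen Gen_a * free_gen Gen_a * free_gen Gen_x"

definition aax_ideal :: "(generator free_monoid \<Rightarrow>\<^sub>0 bit) set"
  where "aax_ideal = Idl\<^bsub>free_algebra\<^esub> {aax_relator}"

lemma ideal_aax_ideal: "ideal aax_ideal free_algebra"
  unfolding aax_ideal_def
  by (intro ring.genideal_ideal ring_free_algebra) (simp add: free_algebra_def)

lemma aax_relator_in_ideal: "aax_relator \<in> aax_ideal"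
  unfolding aax_ideal_def
  by (intro ring.genideal_self' ring_free_algebra) (simp add: free_algebra_def)

lemma aax_ideal_zero: "0 \<in> aax_ideal"
  using additive_subgroup.zero_closed[OF ideal.axioms(1)[OF ideal_aax_ideal]]
  by (simp add: free_algebra_def)

lemma aax_ideal_add: "p \<in> aax_ideal \<Longrightarrow> q \<in> aax_ideal \<Longrightarrow> p + q \<in> aax_ideal"
  using additive_subgroup.a_closed[OF ideal.axioms(1)[OF ideal_aax_ideal]]
  by (simp add: free_algebra_def)

lemma aax_ideal_mult_left: "p \<in> aax_ideal \<Longrightarrow> q * p \<in> aax_ideal"
  using ideal.I_l_closed[OF ideal_aax_ideal] by (simp add: free_algebra_def)

lemma aax_ideal_mult_right: "p \<in> aax_ideal \<Longrightarrow> p * q \<in> aax_ideal"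
  using ideal.I_r_closed[OF ideal_aax_ideal] by (simp add: free_algebra_def)

lemma aax_ideal_uminus: "p \<in> aax_ideal \<Longrightarrow> - p \<in> aax_ideal"
  by (simp add: free_algebra_uminus)

text \<open>
  Right multiplication by \<open>a\<close> and \<open>x\<close> on coefficient sequences: \<open>t\<close>
  stands for the formal sum of the \<open>t k * a ^ k\<close>, and the formulas are dictated by
  \<open>a * x = 1 - z\<close> and \<open>a ^ (k + 2) * x = a ^ (k + 1)\<close>. That they respect the
  relation \<open>a * a * x = a\<close> is the reason why such sums are normal forms.
\<close>

fun coeff_act1 :: "generator \<Rightarrow> (nat \<Rightarrow> free_xz) \<Rightarrow> nat \<Rightarrow> free_xz" where
  "coeff_act1 Gen_a t = (\<lambda>k. case k of 0 \<Rightarrow> 0 | Suc j \<Rightarrow> t j)"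
| "coeff_act1 Gen_x t = (\<lambda>k. if k = 0 then t 0 * gen_x + t 1 * (1 - gen_z) else t (Suc k))"

interpretation coeffs: free_algebra_action coeff_act1
proof
  fix g and m n :: "nat \<Rightarrow> free_xz"
  show "coeff_act1 g (m + n) = coeff_act1 g m + coeff_act1 g n"
    by (cases g) (auto simp: fun_eq_iff distrib_right split: nat.split)
  show "m + m = 0" by (simp add: fun_eq_iff free_algebra_char_2)
qed

lemma aax_ideal_acts_trivially:
  assumes "p \<in> aax_ideal"
  shows "coeffs.act p t = 0"
proof -
  let ?K = "{p. \<forall>t. coeffs.act p t = 0}"
  have "ideal ?K free_algebra"
  proof (rule idealI[OF ring_free_algebra])
    let ?A = "add_monoid (free_algebra :: (generator free_monoid \<Rightarrow>\<^sub>0 bit) ring)"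
    have group: "group ?A"
      using ring_free_algebra ring.is_abelian_group abelian_group.a_group by blast
    show "subgroup ?K ?A"
    proof (rule group.subgroupI[OF group])
      fix p assume p: "p \<in> ?K"
      have "inv\<^bsub>?A\<^esub> p = p"
        by (rule group.inv_equality[OF group]) (simp_all add: free_algebra_def free_algebra_char_2)
      then show "inv\<^bsub>?A\<^esub> p \<in> ?K" using p by simp
    next
      show "?K \<noteq> {}" using coeffs.act_zero by blast
    qed (auto simp: free_algebra_def coeffs.act_add)
  qed (auto simp: free_algebra_def coeffs.act_mult)
  moreover have "aax_relator \<in> ?K"
    by (auto simp: aax_relator_def coeffs.act_diff coeffs.act_mult fun_eq_iff split: nat.split)
  ultimately have "aax_ideal \<subseteq> ?K"
    unfolding aax_ideal_def by (intro ring.genideal_minimal ring_free_algebra) auto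
  then show ?thesis using assms by blast
qed

text \<open>
  The lifting setup of polynomial mappings would unfold the representatives themselves to functions.
\<close>

lifting_forget poly_mapping.lifting

text \<open>
  A copy of the quotient ring as a type of class \<open>ring_1\<close>, where ring identities are matters of
  rewriting.
\<close>

quotient_type aax = "generator free_monoid \<Rightarrow>\<^sub>0 bit" / "\<lambda>p q. p - q \<in> aax_ideal"
proof (rule equivpI)
  show "reflp (\<lambda>p q. p - q \<in> aax_ideal)"
    by (rule reflpI) (simp add: aax_ideal_zero)
  show "symp (\<lambda>p q. p - q \<in> aax_ideal)"
    by (rule sympI) (use aax_ideal_uminus in fastforce)
  show "transp (\<lambda>p q. p - q \<in> aax_ideal)"
  proof (rule transpI)
    fix p q r assume "p - q \<in> aax_ideal" "q - r \<in> aax_ideal"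
    then have "(p - q) + (q - r) \<in> aax_ideal" by (rule aax_ideal_add)
    then show "p - r \<in> aax_ideal" by simp
  qed
qed

lift_definition aax_of :: "(generator free_monoid \<Rightarrow>\<^sub>0 bit) \<Rightarrow> aax" is "\<lambda>p. p" .

lemma aax_of_eq_iff: "aax_of p = aax_of q \<longleftrightarrow> p - q \<in> aax_ideal"
  by transfer rule

text \<open>
  The coefficients of the normal form are read off from the action on the sequence of \<open>1\<close>.
\<close>

lift_definition coeff :: "aax \<Rightarrow> nat \<Rightarrow> free_xz"
  is "\<lambda>p. coeffs.act p (\<lambda>k. if k = 0 then 1 else 0)"
proof -
  fix p q :: "generator free_monoid \<Rightarrow>\<^sub>0 bit" assume "p - q \<in> aax_ideal"
  from aax_ideal_acts_trivially[OF this]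
  show "coeffs.act p (\<lambda>k. if k = 0 then 1 else 0) = coeffs.act q (\<lambda>k. if k = 0 then 1 else 0)"
    by (simp add: coeffs.act_diff)
qed

instantiation aax :: ring_1
begin

lift_definition zero_aax :: aax is 0 .
lift_definition one_aax :: aax is 1 .
lift_definition plus_aax :: "aax \<Rightarrow> aax \<Rightarrow> aax" is "(+)"
proof -
  fix p p' q q' :: "generator free_monoid \<Rightarrow>\<^sub>0 bit"
  assume "p - p' \<in> aax_ideal" "q - q' \<in> aax_ideal"
  then have "(p - p') + (q - q') \<in> aax_ideal" by (rule aax_ideal_add)
  then show "p + q - (p' + q') \<in> aax_ideal" by (simp add: algebra_simps)
qed
lift_definition uminus_aax :: "aax \<Rightarrow> aax" is "uminus"
  by (simp add: free_algebra_uminus)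
lift_definition minus_aax :: "aax \<Rightarrow> aax \<Rightarrow> aax" is "(-)"
proof -
  fix p p' q q' :: "generator free_monoid \<Rightarrow>\<^sub>0 bit"
  assume "p - p' \<in> aax_ideal" "q - q' \<in> aax_ideal"
  then have "(p - p') + - (q - q') \<in> aax_ideal"
    by (intro aax_ideal_add aax_ideal_uminus)
  then show "p - q - (p' - q') \<in> aax_ideal" by (simp add: algebra_simps)
qed
lift_definition times_aax :: "aax \<Rightarrow> aax \<Rightarrow> aax" is "(*)"
proof -
  fix p p' q q' :: "generator free_monoid \<Rightarrow>\<^sub>0 bit"
  assume "p - p' \<in> aax_ideal" "q - q' \<in> aax_ideal"
  then have "(p - p') * q + p' * (q - q') \<in> aax_ideal"
    by (intro aax_ideal_add aax_ideal_mult_left aax_ideal_mult_right)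
  then show "p * q - p' * q' \<in> aax_ideal" by (simp add: algebra_simps)
qed

instance
proof
  fix r s t :: aax
  show "r + s + t = r + (s + t)" "r + s = s + r" "0 + r = r" "- r + r = 0" "r - s = r + - s"
    "r * s * t = r * (s * t)" "1 * r = r" "r * 1 = r" "(r + s) * t = r * t + s * t"
    "r * (s + t) = r * s + r * t"
    by (transfer, simp add: aax_ideal_zero algebra_simps)+
  have "coeff 1 0 \<noteq> coeff 0 0" by transfer simp
  then show "(0::aax) \<noteq> 1" by metis
qed

end

lemma aax_of_hom [simp]:
  "aax_of 0 = 0" "aax_of 1 = 1" "aax_of (p + q) = aax_of p + aax_of q" "aax_of (p * q) = aax_of p * aax_of q"
  "aax_of (p - q) = aax_of p - aax_of q"
  by (simp_all add: zero_aax.abs_eq one_aax.abs_eq plus_aax.abs_eq times_aax.abs_eq minus_aax.abs_eq aax_of.abs_eq)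

lemma aax_of_surj: obtains p where "r = aax_of p"
  using Quotient_abs_rep[OF Quotient_aax, of r] by (metis aax_of.abs_eq)

definition aa :: aax where "aa = aax_of (free_gen Gen_a)"
definition xx :: aax where "xx = aax_of (free_gen Gen_x)"

lemma aax_relation: "aa * aa * xx = aa"
proof -
  have "aax_of (free_gen Gen_a) = aax_of (free_gen Gen_a * free_gen Gen_a * free_gen Gen_x)"
    using aax_relator_in_ideal unfolding aax_of_eq_iff aax_relator_def .
  then show ?thesis by (simp add: aa_def xx_def)
qed

lemma aax_induct [case_names one a x add]:
  assumes "P 1" "\<And>r. P r \<Longrightarrow> P (r * aa)" "\<And>r. P r \<Longrightarrow> P (r * xx)" "\<And>r s. P r \<Longrightarrow> P s \<Longrightarrow> P (r + s)"
  shows "P r"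
proof -
  obtain p where "r = aax_of p" by (rule aax_of_surj)
  moreover have "P (aax_of p)"
  proof (induction p rule: free_algebra_gen_induct)
    case (gen g p)
    then show ?case using assms(2,3) by (cases g) (auto simp: aa_def xx_def)
  qed (use assms in auto)
  ultimately show ?thesis by simp
qed

lemma aax_char_2: "r + r = (0::aax)"
  by transfer (simp add: free_algebra_char_2 aax_ideal_zero)

lemma coeff_zero [simp]: "coeff 0 k = 0"
  by transfer simp

lemma coeff_one: "coeff 1 k = (if k = 0 then 1 else 0)"
  by transfer simp

lemma coeff_add [simp]: "coeff (r + s) k = coeff r k + coeff s k"
  by transfer (simp add: coeffs.act_add)

lemma coeff_diff [simp]: "coeff (r - s) k = coeff r k - coeff s k"
  by transfer (simp add: coeffs.act_diff)

lemma coeff_sum: "coeff (sum f A) k = (\<Sum>i\<in>A. coeff (f i) k)"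
  by (induction A rule: infinite_finite_induct) auto

lemma coeff_mult_aa: "coeff (r * aa) k = (case k of 0 \<Rightarrow> 0 | Suc j \<Rightarrow> coeff r j)"
  unfolding aa_def by transfer (simp add: coeffs.act_mult)

lemma coeff_mult_xx:
  "coeff (r * xx) k = (if k = 0 then coeff r 0 * gen_x + coeff r 1 * (1 - gen_z) else coeff r (Suc k))"
  unfolding xx_def by transfer (simp add: coeffs.act_mult)

lemma coeff_mult_aa_simps [simp]: "coeff (r * aa) 0 = 0" "coeff (r * aa) (Suc k) = coeff r k"
  by (simp_all add: coeff_mult_aa)

lemma coeff_mult_aa_power: "coeff (r * aa ^ n) k = (if k < n then 0 else coeff r (k - n))"
proof (induction n arbitrary: k)
  case (Suc n)
  have snoc: "r * aa ^ Suc n = r * aa ^ n * aa"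
    by (simp only: power_Suc2 mult.assoc)
  show ?case unfolding snoc by (cases k) (simp_all add: Suc)
qed simp

fun letter_image :: "letter \<Rightarrow> aax" where
  "letter_image Letter_x = xx"
| "letter_image Letter_z = 1 - aa * xx"

interpretation emb: free_algebra_action "\<lambda>l r. r * letter_image l"
  by unfold_locales (simp_all add: distrib_right aax_char_2)

definition of_xz :: "free_xz \<Rightarrow> aax"
  where "of_xz s = emb.act s 1"

lemma emb_act_eq: "emb.act s r = r * of_xz s"
  by (induction s rule: free_algebra_gen_induct)
    (simp_all add: of_xz_def emb.act_mult emb.act_add distrib_left mult.assoc)

lemma of_xz_hom [simp]:
  "of_xz 0 = 0" "of_xz 1 = 1" "of_xz (s + t) = of_xz s + of_xz t" "of_xz (s - t) = of_xz s - of_xz t"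
  by (simp_all add: of_xz_def emb.act_add emb.act_diff)

lemma of_xz_mult [simp]: "of_xz (s * t) = of_xz s * of_xz t"
proof -
  have "of_xz (s * t) = emb.act t (emb.act s 1)"
    by (simp only: of_xz_def emb.act_mult)
  then show ?thesis by (simp add: emb_act_eq)
qed

lemma of_xz_x [simp]: "of_xz gen_x = xx" and of_xz_z [simp]: "of_xz gen_z = 1 - aa * xx"
  by (simp_all add: of_xz_def)

lemma coeff_of_xz: "coeff (of_xz s) k = (if k = 0 then s else 0)"
proof (induction s arbitrary: k rule: free_algebra_gen_induct)
  case (gen g s)
  then show ?case
    by (cases g) (auto simp: right_diff_distrib coeff_mult_xx coeff_mult_aa simp flip: mult.assoc split: nat.split)
qed (auto simp: coeff_one)

lemma coeff_of_xz_mult: "coeff (of_xz s * r) k = s * coeff r k"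
proof (induction r arbitrary: k rule: aax_induct)
  case one
  then show ?case by (simp add: coeff_of_xz coeff_one)
qed (auto simp: coeff_mult_xx coeff_mult_aa distrib_left mult.assoc[symmetric] split: nat.split)

text \<open>
  Existence of the normal form, with the coefficients already known. Bounding the sum by every large
  \<open>m\<close> makes the statement stable under addition.
\<close>

lemma expansion_aux: "\<exists>n. \<forall>m\<ge>n. r = (\<Sum>k<m. of_xz (coeff r k) * aa ^ k)"
proof (induction r rule: aax_induct)
  case one
  have "1 = (\<Sum>k<m. of_xz (coeff 1 k) * aa ^ k)" if "m \<ge> 1" for m
    using that by (simp add: coeff_one if_distrib if_distribR sum.delta cong: if_cong)
  then show ?case by blast
next
  case (a r)
  then obtain n where n: "\<And>m. m \<ge> n \<Longrightarrow> r = (\<Sum>k<m. of_xz (coeff r k) * aa ^ k)" by blast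
  have "r * aa = (\<Sum>k<m. of_xz (coeff (r * aa) k) * aa ^ k)" if m_ge: "m \<ge> Suc n" for m
  proof -
    obtain j where m: "m = Suc j" using m_ge by (cases m) auto
    have "(\<Sum>k<m. of_xz (coeff (r * aa) k) * aa ^ k) = (\<Sum>k<j. of_xz (coeff r k) * aa ^ k) * aa"
      unfolding m sum.lessThan_Suc_shift by (simp add: sum_distrib_right power_commutes mult.assoc)
    then show ?thesis using n[of j] that m by simp
  qed
  then show ?case by blast
next
  case (x r)
  then obtain n where n: "\<And>m. m \<ge> n \<Longrightarrow> r = (\<Sum>k<m. of_xz (coeff r k) * aa ^ k)" by blast
  have "r * xx = (\<Sum>k<m. of_xz (coeff (r * xx) k) * aa ^ k)" if m_ge: "m \<ge> Suc n" for m
  proof -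
    obtain j where m: "m = Suc j" using m_ge by (cases m) auto
    have pow: "aa ^ Suc (Suc k) * xx = aa ^ Suc k" for k
    proof -
      have "aa ^ Suc (Suc k) * xx = aa ^ k * (aa * aa * xx)"
        by (simp only: power_Suc2 mult.assoc)
      then show ?thesis by (simp only: aax_relation power_Suc2)
    qed
    have "r * xx = (\<Sum>k<Suc m. of_xz (coeff r k) * aa ^ k) * xx"
      using n[of "Suc m"] that by simp
    also have "\<dots> = of_xz (coeff r 0) * xx + of_xz (coeff r 1) * (aa * xx) +
        (\<Sum>k<j. of_xz (coeff r (Suc (Suc k))) * (aa ^ Suc (Suc k) * xx))"
      unfolding m sum.lessThan_Suc_shift by (simp add: distrib_right sum_distrib_right mult.assoc)
    also have "\<dots> = (\<Sum>k<m. of_xz (coeff (r * xx) k) * aa ^ k)"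
      unfolding m sum.lessThan_Suc_shift pow by (simp add: coeff_mult_xx algebra_simps)
    finally show ?thesis .
  qed
  then show ?case by blast
next
  case (add r s)
  then obtain n n' where "\<And>m. m \<ge> n \<Longrightarrow> r = (\<Sum>k<m. of_xz (coeff r k) * aa ^ k)"
    "\<And>m. m \<ge> n' \<Longrightarrow> s = (\<Sum>k<m. of_xz (coeff s k) * aa ^ k)" by blast
  then have "r + s = (\<Sum>k<m. of_xz (coeff (r + s) k) * aa ^ k)" if "m \<ge> max n n'" for m
    using that by (simp add: distrib_right sum.distrib)
  then show ?case by blast
qed

lemma expansion: obtains n where "r = (\<Sum>k<n. of_xz (coeff r k) * aa ^ k)"
  using expansion_aux by blast

lemma coeff_eqI:
  assumes "\<And>k. coeff r k = coeff s k"
  shows "r = s"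
proof -
  obtain n where "r - s = (\<Sum>k<n. of_xz (coeff (r - s) k) * aa ^ k)" by (rule expansion)
  then show ?thesis using assms by simp
qed

lemma mult_aa_power_eq_0: "r * aa ^ n = 0 \<Longrightarrow> r = 0"
proof (rule coeff_eqI)
  fix k assume "r * aa ^ n = 0"
  then show "coeff r k = coeff 0 k"
    using coeff_mult_aa_power[of r n "k + n"] by simp
qed

lemma left_multiple_of_aa_power:
  assumes "\<And>k. k < n \<Longrightarrow> coeff r k = 0"
  obtains s where "r = s * aa ^ n"
proof -
  obtain m where "r = (\<Sum>k<m. of_xz (coeff r k) * aa ^ k)" by (rule expansion)
  also have "\<dots> = (\<Sum>k<m. of_xz (coeff r k) * aa ^ (k - n)) * aa ^ n"
    unfolding sum_distrib_right
  proof (rule sum.cong)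
    fix k
    show "of_xz (coeff r k) * aa ^ k = of_xz (coeff r k) * aa ^ (k - n) * aa ^ n"
    proof (cases "k < n")
      case False
      then have "aa ^ k = aa ^ (k - n) * aa ^ n" by (simp flip: power_add)
      then show ?thesis by (simp add: mult.assoc)
    qed (simp add: assms)
  qed simp
  finally show ?thesis using that by blast
qed

text \<open>
  Since \<open>a * z = 0\<close>, right multiplication by \<open>z\<close> forgets all coefficients but the
  one at \<open>a ^ 0\<close>.
\<close>

lemma mult_of_xz_z: "r * of_xz gen_z = of_xz (coeff r 0 * gen_z)"
  by (rule coeff_eqI)
    (auto simp: coeff_of_xz right_diff_distrib coeff_mult_xx coeff_mult_aa simp del: of_xz_hom
      simp flip: mult.assoc split: nat.split)

section \<open>Zero divisors\<close>

text \<open>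
  Sorting the words by the number of letters \<open>x\<close> at their beginning.
\<close>

lemma x_power_expansion:
  "\<exists>u n. (\<forall>k. u k \<in> const_plus_z) \<and> (\<forall>m\<ge>n. t = (\<Sum>k<m. gen_x ^ k * u k))"
proof (induction t rule: free_algebra_word_induct)
  case zero
  show ?case by (intro exI[of _ "\<lambda>_. 0"] exI[of _ 0]) (simp add: zero_in_const_plus_z)
next
  case (word ls)
  show ?case
  proof (induction ls)
    case Nil
    have "Poly_Mapping.single (Mon []) 1 = (\<Sum>k<m. gen_x ^ k * (if k = 0 then 1 else 0))" if "m \<ge> 1" for m
      using that by (simp add: if_distrib sum.delta zero_free_monoid_def[symmetric] cong: if_cong)
    then show ?case
      using zero_in_const_plus_z one_in_const_plus_z
      by (intro exI[of _ "\<lambda>k. if k = 0 then 1 else 0"] exI[of _ 1]) simp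
  next
    case (Cons l ls)
    let ?w = "Poly_Mapping.single (Mon ls) (1::bit)"
    obtain u n where u: "\<And>k. u k \<in> const_plus_z" "\<And>m. m \<ge> n \<Longrightarrow> ?w = (\<Sum>k<m. gen_x ^ k * u k)"
      using Cons by blast
    show ?case
    proof (cases l)
      case Letter_x
      define v where "v k = (case k of 0 \<Rightarrow> 0 | Suc j \<Rightarrow> u j)" for k
      have "gen_x * ?w = (\<Sum>k<m. gen_x ^ k * v k)" if m_ge: "m \<ge> Suc n" for m
      proof -
        obtain j where m: "m = Suc j" using m_ge by (cases m) auto
        have "(\<Sum>k<m. gen_x ^ k * v k) = gen_x * (\<Sum>k<j. gen_x ^ k * u k)"
          unfolding m sum.lessThan_Suc_shift by (simp add: v_def sum_distrib_left mult.assoc)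
        then show ?thesis using u(2)[of j] m m_ge by simp
      qed
      moreover have "v k \<in> const_plus_z" for k
        using u(1) zero_in_const_plus_z by (simp add: v_def split: nat.split)
      ultimately show ?thesis unfolding single_letters_Cons Letter_x by blast
    next
      case Letter_z
      have "gen_z * ?w = (\<Sum>k<m. gen_x ^ k * (if k = 0 then gen_z * ?w else 0))" if "m \<ge> 1" for m
        using that by (simp add: if_distrib sum.delta cong: if_cong)
      then show ?thesis
        unfolding single_letters_Cons Letter_z using zero_in_const_plus_z z_mult_in_const_plus_z
        by (intro exI[of _ "\<lambda>k. if k = 0 then gen_z * ?w else 0"] exI[of _ 1]) simp
    qed
  qed
next
  case (add p q)
  then obtain u n v n' where u: "\<And>k. u k \<in> const_plus_z" "\<And>m. m \<ge> n \<Longrightarrow> p = (\<Sum>k<m. gen_x ^ k * u k)"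
    and v: "\<And>k. v k \<in> const_plus_z" "\<And>m. m \<ge> n' \<Longrightarrow> q = (\<Sum>k<m. gen_x ^ k * v k)"
    by blast
  have "p + q = (\<Sum>k<m. gen_x ^ k * (u k + v k))" if "m \<ge> max n n'" for m
    using u(2)[of m] v(2)[of m] that by (simp add: distrib_left sum.distrib)
  then show ?case using u(1) v(1) add_in_const_plus_z
    by (intro exI[of _ "\<lambda>k. u k + v k"] exI[of _ "max n n'"]) simp
qed

text \<open>
  The left ideal \<open>R a\<close> consists of the elements with coefficient \<open>0\<close> at
  \<open>a ^ 0\<close>, so this is the action of \<open>g\<close> on \<open>R / R a\<close>, which is a copy
  of \<open>S\<close>.
\<close>

lemma coeff_0_mult: "coeff (g * f) 0 = coeff (g * of_xz (coeff f 0)) 0"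
proof -
  obtain h where h: "f - of_xz (coeff f 0) = h * aa ^ 1"
    by (rule left_multiple_of_aa_power[of 1 "f - of_xz (coeff f 0)"]) (simp add: coeff_of_xz)
  have "g * f = g * of_xz (coeff f 0) + g * (f - of_xz (coeff f 0))"
    by (simp add: right_diff_distrib)
  also have "\<dots> = g * of_xz (coeff f 0) + g * h * aa"
    unfolding h by (simp add: mult.assoc)
  finally show ?thesis by simp
qed

lemma coeff_0_mult_const_plus_z:
  assumes "u \<in> const_plus_z"
  shows "coeff (r * of_xz u) 0 = coeff r 0 * u"
proof -
  have z: "coeff (r * of_xz (gen_z * q)) 0 = coeff r 0 * (gen_z * q)" for q
  proof -
    have "r * of_xz (gen_z * q) = of_xz (coeff r 0 * (gen_z * q))"
      using mult_of_xz_z[of r] by (simp only: of_xz_mult mult.assoc[symmetric])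
    then show ?thesis by (simp only: coeff_of_xz if_True simp_thms)
  qed
  from assms obtain q where "u = gen_z * q \<or> u = 1 + gen_z * q"
    by (auto simp: const_plus_z_def)
  then show ?thesis
    using z[of q] by (auto simp: distrib_left simp del: of_xz_mult of_xz_z)
qed

text \<open>
  Cancelling a power of \<open>a\<close>, one may assume that \<open>f\<close> does not lie in
  \<open>R a\<close> and replace it by its image in \<open>R / R a = S\<close>, a sum of terms
  \<open>x ^ k * u k\<close> with \<open>u k\<close> in \<open>F + z S\<close>. Then
  \<open>g * f = 0\<close> is a right relation with coefficients \<open>u k\<close> between the
  \<open>coeff (g * x ^ k) 0\<close>. These satisfy the recursion of
  \<open>coefficient_sequence_independent\<close>, and if \<open>coeff g 0\<close> were not zero, all
  \<open>u k\<close> would vanish.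
\<close>

lemma mult_eq_0_imp_left_factor_in_left_ideal_aa:
  assumes "g * f = 0" "f \<noteq> 0"
  shows "coeff g 0 = 0"
proof (rule ccontr)
  assume g: "coeff g 0 \<noteq> 0"
  obtain j where "coeff f j \<noteq> 0" using \<open>f \<noteq> 0\<close> coeff_eqI[of f 0] by auto
  then obtain j where j: "coeff f j \<noteq> 0" and below: "\<And>i. i < j \<Longrightarrow> coeff f i = 0"
    using exists_least_iff[of "\<lambda>j. coeff f j \<noteq> 0"] by blast
  obtain f' where f': "f = f' * aa ^ j" using left_multiple_of_aa_power below by blast
  have "g * f' = 0" using assms(1) mult_aa_power_eq_0[of "g * f'" j] by (simp add: f' mult.assoc)
  have t: "coeff f' 0 \<noteq> 0" using j coeff_mult_aa_power[of f' j j] by (simp add: f')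
  obtain u n where u: "\<And>k. u k \<in> const_plus_z" "coeff f' 0 = (\<Sum>k<n. gen_x ^ k * u k)"
    using x_power_expansion[of "coeff f' 0"] by blast
  have of_sum: "of_xz (sum h A) = (\<Sum>k\<in>A. of_xz (h k))" for h and A :: "nat set"
    by (induction A rule: infinite_finite_induct) auto
  have of_pow: "of_xz (gen_x ^ k) = xx ^ k" for k by (induction k) auto
  have "0 = coeff (g * f') 0" using \<open>g * f' = 0\<close> by simp
  also have "\<dots> = coeff (g * of_xz (coeff f' 0)) 0" by (rule coeff_0_mult)
  also have "\<dots> = (\<Sum>k<n. coeff (g * xx ^ k * of_xz (u k)) 0)"
    by (simp add: u(2) of_sum of_pow sum_distrib_left coeff_sum mult.assoc)
  also have "\<dots> = (\<Sum>k<n. coeff (g * xx ^ k) 0 * u k)"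
    using u(1) by (simp add: coeff_0_mult_const_plus_z)
  finally have sum: "(\<Sum>k<n. coeff (g * xx ^ k) 0 * u k) = 0" by simp
  have "coeff (g * xx ^ Suc k) 0 = coeff (g * xx ^ k) 0 * gen_x + coeff (g * xx ^ k) 1 * (1 - gen_z)" for k
    using coeff_mult_xx[of "g * xx ^ k" 0] by (simp only: power_Suc2 mult.assoc) simp
  then have "u k = 0" if "k < n" for k
    using coefficient_sequence_independent[of "\<lambda>k. coeff (g * xx ^ k) 0" "\<lambda>k. coeff (g * xx ^ k) 1" u n k]
      g u(1) sum that by simp
  then show False using t u(2) by simp
qed

text \<open>
  Otherwise \<open>e\<close> and \<open>1 - e\<close>, which annihilate each other, and hence
  \<open>1\<close> would lie in \<open>R a\<close>.
\<close>

lemma idempotent_trivial: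
  fixes e :: aax
  assumes "e * e = e"
  shows "e = 0 \<or> e = 1"
proof (rule ccontr)
  assume "\<not> ?thesis"
  moreover have "e * (1 - e) = 0" "(1 - e) * e = 0"
    using assms by (simp_all add: algebra_simps)
  ultimately have "coeff e 0 = 0" "coeff (1 - e) 0 = 0"
    using mult_eq_0_imp_left_factor_in_left_ideal_aa by (metis right_minus_eq)+
  then show False by (simp add: coeff_one)
qed

text \<open>
  Here \<open>g\<close> lies in \<open>R a ^ n\<close>: once \<open>g = h * a ^ j\<close>, the factor
  \<open>h\<close> annihilates \<open>a ^ j * f\<close>.
\<close>

lemma mult_eq_0_imp_coeffs_below_0:
  assumes "g * f = 0" "\<And>j. j < n \<Longrightarrow> aa ^ j * f \<noteq> 0" "k < n"
  shows "coeff g k = 0"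
  using assms(2,3)
proof (induction n arbitrary: k)
  case (Suc n)
  then have below: "coeff g i = 0" if "i < n" for i using that by simp
  then obtain h where h: "g = h * aa ^ n" using left_multiple_of_aa_power by blast
  have "h * (aa ^ n * f) = 0" using assms(1) by (simp add: h mult.assoc)
  then have "coeff h 0 = 0"
    using Suc.prems(1) by (intro mult_eq_0_imp_left_factor_in_left_ideal_aa) auto
  then have "coeff g n = 0" by (simp add: h coeff_mult_aa_power)
  then show ?case using below Suc.prems by (cases "k = n") auto
qed simp

section \<open>Surjective endomorphisms of free modules of finite rank\<close>

definition order_ge :: "nat \<Rightarrow> ('a free_monoid \<Rightarrow>\<^sub>0 bit) \<Rightarrow> bool"
  where "order_ge i p \<longleftrightarrow> (\<forall>w\<in>Poly_Mapping.keys p. i \<le> len w)"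

definition truncate :: "nat \<Rightarrow> ('a free_monoid \<Rightarrow>\<^sub>0 bit) \<Rightarrow> ('a free_monoid \<Rightarrow>\<^sub>0 bit)"
  where "truncate i = Poly_Mapping.mapp (\<lambda>w c. if len w < i then c else 0)"

lemma lookup_truncate: "Poly_Mapping.lookup (truncate i p) w = (if len w < i then Poly_Mapping.lookup p w else 0)"
  by (auto simp: truncate_def lookup_mapp when_def in_keys_iff)

lemma truncate_add [simp]: "truncate i (p + q) = truncate i p + truncate i q"
  by (rule poly_mapping_eqI) (simp add: lookup_truncate lookup_add)

lemma truncate_diff [simp]: "truncate i (p - q) = truncate i p - truncate i q"
  by (rule poly_mapping_eqI) (simp add: lookup_truncate lookup_minus)

lemma truncate_zero [simp]: "truncate i 0 = 0"
  by (rule poly_mapping_eqI) (simp add: lookup_truncate)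

lemma truncate_truncate [simp]: "truncate i (truncate i p) = truncate i p"
  by (rule poly_mapping_eqI) (simp add: lookup_truncate)

lemma truncate_eq_0_iff: "truncate i p = 0 \<longleftrightarrow> order_ge i p"
proof -
  have "truncate i p = 0 \<longleftrightarrow> (\<forall>w. Poly_Mapping.lookup (truncate i p) w = 0)"
    by (metis poly_mapping_eqI lookup_zero)
  also have "\<dots> \<longleftrightarrow> order_ge i p"
    unfolding lookup_truncate order_ge_def Ball_def in_keys_iff
  proof (rule iff_allI)
    fix w
    show "(if len w < i then Poly_Mapping.lookup p w else 0) = 0 \<longleftrightarrow> (Poly_Mapping.lookup p w \<noteq> 0 \<longrightarrow> i \<le> len w)"
      by (cases "Poly_Mapping.lookup p w") auto
  qed
  finally show ?thesis .
qed

lemma order_ge_mult: "order_ge i p \<Longrightarrow> order_ge i (p * q)"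
  using Poly_Mapping.keys_mult[of p q] by (fastforce simp: order_ge_def len_def plus_free_monoid_def)

lemma truncate_size_deg: "truncate (size_deg p) p = p"
  by (rule poly_mapping_eqI) (metis in_keys_iff lookup_truncate order_refl size_deg_le_iff)

lemma finite_truncated: "finite {p :: free_xz. truncate i p = p}"
proof (rule finite_imageD)
  have "finite (Mon ` {ls :: letter list. set ls \<subseteq> UNIV \<and> length ls \<le> i})"
    by (intro finite_imageI finite_lists_length_le) simp
  moreover have "Poly_Mapping.keys p \<subseteq> Mon ` {ls. set ls \<subseteq> UNIV \<and> length ls \<le> i}"
    if "truncate i p = p" for p :: free_xz
  proof
    fix w assume w: "w \<in> Poly_Mapping.keys p"
    then have "len w < i" using that by (metis in_keys_iff lookup_truncate)
    then show "w \<in> Mon ` {ls. set ls \<subseteq> UNIV \<and> length ls \<le> i}"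
      by (intro image_eqI[of _ _ "letters w"]) (auto simp: len_def)
  qed
  ultimately show "finite (Poly_Mapping.keys ` {p :: free_xz. truncate i p = p})"
    by (intro finite_subset[OF _ finite_Pow_iff[THEN iffD2]]) auto
  show "inj_on Poly_Mapping.keys {p :: free_xz. truncate i p = p}"
  proof (rule inj_onI)
    fix p q :: free_xz assume eq: "Poly_Mapping.keys p = Poly_Mapping.keys q"
    show "p = q"
    proof (rule poly_mapping_eqI)
      fix w
      show "Poly_Mapping.lookup p w = Poly_Mapping.lookup q w"
        using eq by (cases "Poly_Mapping.lookup p w"; cases "Poly_Mapping.lookup q w") (auto simp: in_keys_iff set_eq_iff)
    qed
  qed
qed

text \<open>
  Right multiplication by \<open>f\<close> is an endomorphism of \<open>R / R a ^ n\<close>, which is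
  surjective because it hits \<open>1\<close>. As a left \<open>S\<close>-module \<open>R / R a ^ n\<close>
  is free with basis \<open>1, \<dots>, a ^ (n - 1)\<close>. The endomorphism preserves the submodule of
  elements all of whose coefficients have order at least \<open>i\<close>, and the quotient by it is a
  finite set, on which a surjective map is injective. So the coefficients of an element of the kernel have
  order at least \<open>i\<close> for every \<open>i\<close>.
\<close>

lemma surjective_right_mult_injective:
  assumes kill: "aa ^ n * f = 0" and inv: "\<And>k. k < n \<Longrightarrow> coeff (r * f - 1) k = 0"
    and sf: "\<And>k. k < n \<Longrightarrow> coeff (s * f) k = 0" and "k < n"
  shows "coeff s k = 0"
proof -
  have "truncate i (coeff s k) = 0" for i
  proof -
    \<comment> \<open>\<open>T\<close> is a set of representatives for the finite quotient, \<open>lift\<close> goes back to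
      the ring, and \<open>trunc\<close> is the projection.\<close>
    define trunc where "trunc m = (\<lambda>k. if k < n then truncate i (coeff m k) else 0)" for m
    define lift where "lift h = (\<Sum>k<n. of_xz (h k) * aa ^ k)" for h :: "nat \<Rightarrow> free_xz"
    define T :: "(nat \<Rightarrow> free_xz) set" where "T = {h. (\<forall>k<n. truncate i (h k) = h k) \<and> (\<forall>k\<ge>n. h k = 0)}"
    have coeff_lift: "coeff (lift h) k = (if k < n then h k else 0)" for h k
    proof -
      have "coeff (lift h) k = (\<Sum>j<n. if j = k then h k else 0)"
        unfolding lift_def coeff_sum by (rule sum.cong) (auto simp: coeff_of_xz_mult coeff_mult_aa_power[of 1, simplified] coeff_one)
      then show ?thesis by simp
    qed
    have trunc_lift: "trunc (lift h) = h" if "h \<in> T" for h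
      using that by (auto simp: trunc_def coeff_lift T_def fun_eq_iff)
    have trunc_T: "trunc m \<in> T" for m by (simp add: trunc_def T_def)
    have trunc_eq: "trunc m = trunc m'" if "\<And>k. k < n \<Longrightarrow> order_ge i (coeff (m - m') k)" for m m'
      using that by (auto simp: trunc_def fun_eq_iff simp flip: truncate_eq_0_iff)
    \<comment> \<open>Right multiplication by \<open>f\<close> is well defined on the quotient.\<close>
    have depends: "trunc (m * f) = trunc (lift (trunc m) * f)" for m
    proof (rule trunc_eq)
      fix k
      define d where "d = m - lift (trunc m)"
      define h where "h = lift (coeff d)"
      have "coeff (d - h) j = 0" if "j < n" for j using that by (simp add: h_def coeff_lift)
      then obtain c where "d - h = c * aa ^ n" using left_multiple_of_aa_power by blast
      then have "(d - h) * f = 0" using kill by (simp add: mult.assoc)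
      then have df: "d * f = (\<Sum>j<n. of_xz (coeff d j) * (aa ^ j * f))"
        by (simp add: h_def lift_def left_diff_distrib sum_distrib_right mult.assoc)
      have "order_ge i (coeff d j)" if "j < n" for j
        using that by (simp add: d_def coeff_lift trunc_def flip: truncate_eq_0_iff)
      then have "truncate i (coeff (of_xz (coeff d j) * (aa ^ j * f)) k) = 0" if "j < n" for j
        using that by (simp add: coeff_of_xz_mult truncate_eq_0_iff order_ge_mult)
      moreover have "truncate i (sum c A) = (\<Sum>j\<in>A. truncate i (c j))" for c :: "nat \<Rightarrow> free_xz" and A
        by (induction A rule: infinite_finite_induct) auto
      ultimately have "truncate i (coeff (d * f) k) = 0" by (simp add: df coeff_sum)
      then show "order_ge i (coeff (m * f - lift (trunc m) * f) k)"
        by (simp add: d_def left_diff_distrib flip: truncate_eq_0_iff)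
    qed
    define \<Phi> where "\<Phi> h = trunc (lift h * f)" for h
    have "finite T"
    proof (rule finite_subset)
      show "T \<subseteq> {h. \<forall>k. (k \<in> {..<n} \<longrightarrow> h k \<in> {p. truncate i p = p}) \<and> (k \<notin> {..<n} \<longrightarrow> h k = 0)}"
        by (auto simp: T_def)
      show "finite {h. \<forall>k. (k \<in> {..<n} \<longrightarrow> h k \<in> {p :: free_xz. truncate i p = p}) \<and> (k \<notin> {..<n} \<longrightarrow> h k = 0)}"
        by (intro finite_set_of_finite_funs finite_truncated) simp
    qed
    moreover have "T \<subseteq> \<Phi> ` T"
    proof
      fix h assume h: "h \<in> T"
      obtain c where c: "r * f - 1 = c * aa ^ n" using left_multiple_of_aa_power inv by blast
      have "lift h * r * f = lift h * (r * f - 1) + lift h" by (simp add: algebra_simps)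
      then have "lift h * r * f = lift h * c * aa ^ n + lift h" by (simp add: c mult.assoc)
      then have "trunc (lift h * r * f) = trunc (lift h)"
        by (simp add: trunc_def fun_eq_iff coeff_mult_aa_power)
      then have "h = \<Phi> (trunc (lift h * r))"
        using depends[of "lift h * r"] h by (simp add: \<Phi>_def trunc_lift)
      then show "h \<in> \<Phi> ` T" using trunc_T by blast
    qed
    ultimately have inj: "inj_on \<Phi> T" by (rule finite_surj_inj)
    have "\<Phi> (trunc s) = trunc (s * f)" by (simp add: \<Phi>_def depends[of s])
    also have "\<dots> = (\<lambda>_. 0)" using sf by (simp add: trunc_def fun_eq_iff)
    also have "\<dots> = \<Phi> (\<lambda>_. 0)" by (simp add: \<Phi>_def lift_def trunc_def fun_eq_iff)
    finally have "trunc s = (\<lambda>_. 0)"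
      using inj trunc_T by (auto simp: T_def dest: inj_onD)
    then show ?thesis using \<open>k < n\<close> by (metis trunc_def)
  qed
  then show ?thesis using truncate_size_deg by metis
qed

section \<open>Left strongly regular elements\<close>

text \<open>
  With \<open>g = 1 - r * f\<close>, which annihilates \<open>f\<close>, the main point is
  \<open>g = 0\<close>. Otherwise the left annihilator of \<open>f\<close> is \<open>R a ^ n\<close> for the
  least \<open>n\<close> with \<open>a ^ n * f = 0\<close>, and right multiplication by \<open>f\<close> is
  surjective on \<open>R / R a ^ n\<close>, hence injective. So \<open>R f\<close> meets the annihilator
  only in \<open>0\<close>. Since \<open>f * g\<close> lies in both, \<open>g\<close> is idempotent, which
  leaves only \<open>g = 1\<close> and thus \<open>f = 0\<close>.
\<close>

lemma left_strongly_regular_imp_zero_or_unit: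
  fixes f r :: aax
  assumes f: "f = r * (f * f)"
  shows "f = 0 \<or> r * f = 1 \<and> f * r = 1"
proof (cases "f = 0")
  case False
  define g where "g = 1 - r * f"
  have gf: "g * f = 0" using f by (simp add: g_def algebra_simps)
  have "g = 0"
  proof (rule ccontr)
    assume "g \<noteq> 0"
    then obtain j where "coeff g j \<noteq> 0" using coeff_eqI[of g 0] by auto
    then have "\<exists>n. aa ^ n * f = 0"
      using mult_eq_0_imp_coeffs_below_0[OF gf, of "Suc j" j] by auto
    then obtain n where kill: "aa ^ n * f = 0" and "\<And>j. j < n \<Longrightarrow> aa ^ j * f \<noteq> 0"
      using exists_least_iff[of "\<lambda>n. aa ^ n * f = 0"] by blast
    \<comment> \<open>This and the next fact say that the left annihilator of \<open>f\<close> is \<open>R a ^ n\<close>.\<close>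
    then have ann: "coeff h k = 0" if "h * f = 0" "k < n" for h k
      using mult_eq_0_imp_coeffs_below_0 that by blast
    have ann': "h * f = 0" if "\<And>k. k < n \<Longrightarrow> coeff h k = 0" for h
      using left_multiple_of_aa_power[OF that] kill by (metis mult.assoc mult_zero_right)
    have "coeff (r * f - 1) k = 0" if "k < n" for k
      using ann[OF gf that] by (simp add: g_def)
    note inj = surjective_right_mult_injective[OF kill this]
    have fg: "f * g = (1 - f * r) * f" by (simp add: g_def algebra_simps)
    have "(1 - f * r) * f * f = 0" using gf by (simp add: fg[symmetric] mult.assoc)
    then have "coeff ((1 - f * r) * f) k = 0" if "k < n" for k using ann that by blast
    then have "coeff (1 - f * r) k = 0" if "k < n" for k using inj that by blast
    then have "f * g = 0" using ann' fg by simp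
    then have "r * f * g = 0" by (simp add: mult.assoc)
    then have "g * g = g" by (simp add: g_def algebra_simps)
    then have "g = 1" using idempotent_trivial \<open>g \<noteq> 0\<close> by blast
    then have "f = 0" using gf by simp
    then show False using False by simp
  qed
  then have rf: "r * f = 1" by (simp add: g_def)
  have "f * r * (f * r) = f * (r * f) * r" by (simp only: mult.assoc)
  then have "f * r = 0 \<or> f * r = 1" using rf idempotent_trivial by simp
  moreover have "f * r \<noteq> 0"
  proof
    assume "f * r = 0"
    then have "f * (r * f) = 0" by (simp flip: mult.assoc)
    then show False using rf False by simp
  qed
  ultimately show ?thesis using rf by simp
qed simp

section \<open>The quotient ring\<close>

definition residue :: "(generator free_monoid \<Rightarrow>\<^sub>0 bit) \<Rightarrow> (generator free_monoid \<Rightarrow>\<^sub>0 bit) set"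
  where "residue p = aax_ideal +>\<^bsub>free_algebra\<^esub> p"

lemma ring_aax_eq: "ring_aax = free_algebra Quot aax_ideal"
  by (simp add: ring_aax_def aax_ideal_def aax_relator_def)

lemma residue_ring_hom: "residue \<in> ring_hom free_algebra ring_aax"
  using ideal.rcos_ring_hom[OF ideal_aax_ideal] by (simp add: residue_def[abs_def] ring_aax_eq)

lemma residue_closed [simp]: "residue p \<in> carrier ring_aax"
  using ring_hom_closed[OF residue_ring_hom, of p] by (simp add: free_algebra_def)

lemma residue_mult: "residue p \<otimes>\<^bsub>ring_aax\<^esub> residue q = residue (p * q)"
  using ring_hom_mult[OF residue_ring_hom, of p q] by (simp add: free_algebra_def)

lemma residue_one: "\<one>\<^bsub>ring_aax\<^esub> = residue 1"
  using ring_hom_one[OF residue_ring_hom] by (simp add: free_algebra_def)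

lemma residue_zero: "\<zero>\<^bsub>ring_aax\<^esub> = residue 0"
  using ring_hom_zero[OF residue_ring_hom ring_free_algebra ring_ring_aax] by (simp add: free_algebra_def)

lemma residue_surj:
  assumes "f \<in> carrier ring_aax"
  obtains p where "f = residue p"
  using assms by (auto simp: ring_aax_eq FactRing_def A_RCOSETS_def' residue_def)

lemma residue_eq_iff: "residue p = residue q \<longleftrightarrow> aax_of p = aax_of q"
proof -
  interpret ring "free_algebra :: (generator free_monoid \<Rightarrow>\<^sub>0 bit) ring" by (rule ring_free_algebra)
  have "p \<ominus>\<^bsub>free_algebra\<^esub> q = p - q"
  proof -
    have "\<ominus>\<^bsub>free_algebra\<^esub> q = - q"
      by (rule minus_equality) (simp_all add: free_algebra_def)
    then show ?thesis by (simp add: a_minus_def free_algebra_def)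
  qed
  then show ?thesis
    using quotient_eq_iff_same_a_r_cos[OF ideal_aax_ideal, of p q]
    by (simp add: residue_def aax_of_eq_iff free_algebra_def)
qed

lemma left_strongly_regular_ring_aax:
  assumes f: "f \<in> carrier ring_aax" and "left_strongly_regular ring_aax f"
  shows "f = \<zero>\<^bsub>ring_aax\<^esub> \<or> f \<in> Units ring_aax"
proof -
  interpret ring ring_aax by (rule ring_ring_aax)
  obtain t where t: "t \<in> carrier ring_aax" "f = t \<otimes>\<^bsub>ring_aax\<^esub> (f \<otimes>\<^bsub>ring_aax\<^esub> f)"
    using assms by (auto simp: left_strongly_regular_def numeral_2_eq_2)
  obtain p where p: "f = residue p" using residue_surj[OF f] .
  obtain r where r: "t = residue r" using residue_surj[OF t(1)] .
  have "residue p = residue (r * (p * p))" using t(2) by (simp add: p r residue_mult)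
  then have "aax_of p = aax_of r * (aax_of p * aax_of p)" by (simp add: residue_eq_iff)
  then have "aax_of p = 0 \<or> aax_of r * aax_of p = 1 \<and> aax_of p * aax_of r = 1"
    by (rule left_strongly_regular_imp_zero_or_unit)
  then have "residue p = residue 0 \<or> residue (r * p) = residue 1 \<and> residue (p * r) = residue 1"
    by (simp add: residue_eq_iff)
  then show ?thesis
    by (auto simp: p residue_zero Units_def residue_one residue_mult intro: bexI[of _ "residue r"])
qed

(* PIdl f is {r * f | r. r in R}, i.e. the principal left ideal R f. *)
theorem theorem3p10:
  shows "left_Dischinger ring_aax \<and>
    (\<forall>f\<in>carrier ring_aax.
      PIdl\<^bsub>ring_aax\<^esub> f = PIdl\<^bsub>ring_aax\<^esub> (f [^]\<^bsub>ring_aax\<^esub> (2::nat)) \<longrightarrow>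
      f = \<zero>\<^bsub>ring_aax\<^esub> \<or> f \<in> Units ring_aax)"
proof (intro conjI ballI impI)
  interpret ring ring_aax by (rule ring_ring_aax)
  show "left_Dischinger ring_aax"
    unfolding left_Dischinger_def
  proof (intro ballI impI)
    fix f assume f: "f \<in> carrier ring_aax" "left_strongly_regular ring_aax f"
    have "\<exists>t\<in>carrier ring_aax. f = f \<otimes>\<^bsub>ring_aax\<^esub> f \<otimes>\<^bsub>ring_aax\<^esub> t"
    proof (cases "f = \<zero>\<^bsub>ring_aax\<^esub>")
      case True
      then show ?thesis by auto
    next
      case False
      then have "f \<in> Units ring_aax" using left_strongly_regular_ring_aax f by blast
      then show ?thesis
        using f(1) by (intro bexI[of _ "inv\<^bsub>ring_aax\<^esub> f"]) (simp_all add: m_assoc)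
    qed
    then show "strongly_regular ring_aax f"
      using f by (simp add: strongly_regular_def right_strongly_regular_def numeral_2_eq_2)
  qed
  fix f assume f: "f \<in> carrier ring_aax"
    and eq: "PIdl\<^bsub>ring_aax\<^esub> f = PIdl\<^bsub>ring_aax\<^esub> (f [^]\<^bsub>ring_aax\<^esub> (2::nat))"
  have "f \<in> PIdl\<^bsub>ring_aax\<^esub> f"
    using f by (auto simp: cgenideal_def intro!: exI[of _ "\<one>\<^bsub>ring_aax\<^esub>"])
  then have "left_strongly_regular ring_aax f"
    unfolding eq by (auto simp: cgenideal_def left_strongly_regular_def)
  then show "f = \<zero>\<^bsub>ring_aax\<^esub> \<or> f \<in> Units ring_aax"
    using left_strongly_regular_ring_aax f by blast
qed

end
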